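(* Let $\alpha\in(0,2]$, $\alpha\ne1$, $|\theta|\le\min\{\alpha,2-\alpha\}$, and let $t\mapsto b(t)$ be a continuous, bounded, strictly positive function on $[0,\infty)$. Let $G^{II}_{\alpha,\theta}(t)=S_{\alpha,\theta}(\Gamma^I(t))$, $t\ge 0$, be the second-type inhomogeneous geometric stable process. Let $f\in\mathcal{S}(\mathbb{R})$ and $s\ge0$. Then $$u(x,t)=T_{s,t}^{G^{II}_{\alpha,\theta}}f(x):=\mathbb{E}\big[f(G^{II}_{\alpha,\theta}(t))\,\big|\,G^{II}_{\alpha,\theta}(s)=x\big]$$ satisfies the initial value problem $$\begin{cases}\dfrac{\partial}{\partial t}u(x,t)=\mathcal{P}^{\alpha,\theta}_{b(t),x}u(x,t),& t\ge s,\\[4pt] u(x,s)=f(x).\end{cases}$$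
   Context: Put $\psi_{\alpha,\theta}(\xi)=|\xi|^\alpha e^{i\,\mathrm{sign}(\xi)\pi\theta/2}$. $S_{\alpha,\theta}$ is the $\alpha$-stable Lévy process with $\mathbb{E}e^{i\xi S_{\alpha,\theta}(t)}=e^{-t\psi_{\alpha,\theta}(\xi)}$. The inhomogeneous Gamma subordinator $\Gamma^I$, independent of $S_{\alpha,\theta}$, is the additive process (stochastically continuous, started at $0$, independent increments) with joint characteristic functions $$\mathbb{E}e^{i\sum_{j=1}^d\xi_j\Gamma^I(t_j)}=\exp\Big\{-\int_0^\infty\ln\Big(1-ib(s)\sum_{j=1}^d\xi_j1_{(0,t_j)}(s)\Big)ds\Big\},\quad \xi_j\in\mathbb{R},\ t_j\ge0,\ d\in\mathbb{N}.$$ The process $G^{II}_{\alpha,\theta}$ is additive, and for an additive process $X$ the conditional expectation $\mathbb{E}[f(X(t))|X(s)=x]$ is $\mathbb{E}f(x+X(t)-X(s))$. Fourier transform: $\tilde f(\xi)=\frac1{\sqrt{2\pi}}\int_{\mathbb{R}}e^{-i\xi x}f(x)dx$. The operator $\overline{\mathcal{D}^{\alpha,\theta}}$ (adjoint of the Riesz–Feller fractional derivative) is the Fourier multiplier with symbol $-\psi_{\alpha,\theta}(\xi)$. The operator $$\mathcal{P}_{b(t)}^{\alpha,\theta}:=-\ln\big(1-b(t)\overline{\mathcal{D}^{\alpha,\theta}}\big)=\int_{b(t)^{-1}}^\infty\frac1z\,\overline{\mathcal{D}^{\alpha,\theta}}\big(z-\overline{\mathcal{D}^{\alpha,\theta}}\big)^{-1}dz$$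 has symbol $-\ln(1+b(t)\psi_{\alpha,\theta}(\xi))$ (principal branch); it acts as a Fourier multiplier on functions (such as $u(\cdot,t)$) which are inverse Fourier transforms of functions decaying faster than any power. The subscript $x$ means the operator acts in the variable $x$. At $t=s$ the time derivative is the right derivative. $\mathcal{S}(\mathbb{R})$ is the Schwartz space. *)

theory Defs
  imports "HOL-Probability.Probability"
begin

section \<open>Processes with time set the nonnegative reals\<close>

text \<open>
  A process is a family \<open>X :: real \<Rightarrow> 'a \<Rightarrow> real\<close> of which only the values
  \<open>X t\<close> with \<open>t \<ge> 0\<close> are ever constrained.
\<close>

context prob_space
begin

definition process :: "(real \<Rightarrow> 'a \<Rightarrow> real) \<Rightarrow> bool" where
  "process X \<longleftrightarrow> (\<forall>t\<ge>0. random_variable borel (X t))"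

definition independent_increments :: "(real \<Rightarrow> 'a \<Rightarrow> real) \<Rightarrow> bool" where
  "independent_increments X \<longleftrightarrow>
     (\<forall>(n::nat) (t :: nat \<Rightarrow> real). 0 \<le> t 0 \<longrightarrow> (\<forall>i<n. t i \<le> t (Suc i)) \<longrightarrow>
        indep_vars (\<lambda>_. borel) (\<lambda>i \<omega>. X (t (Suc i)) \<omega> - X (t i) \<omega>) {..<n})"

definition stationary_increments :: "(real \<Rightarrow> 'a \<Rightarrow> real) \<Rightarrow> bool" where
  "stationary_increments X \<longleftrightarrow>
     (\<forall>s\<ge>0. \<forall>t\<ge>0. distr M borel (\<lambda>\<omega>. X (s + t) \<omega> - X s \<omega>) = distr M borel (\<lambda>\<omega>. X t \<omega> - X 0 \<omega>))"

definition stochastically_continuous :: "(real \<Rightarrow> 'a \<Rightarrow> real) \<Rightarrow> bool" where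
  "stochastically_continuous X \<longleftrightarrow>
     (\<forall>t\<ge>0. \<forall>\<epsilon>>0. ((\<lambda>s. prob {\<omega> \<in> space M. \<bar>X s \<omega> - X t \<omega>\<bar> > \<epsilon>}) \<longlongrightarrow> 0) (at t within {0..}))"

definition additive_process :: "(real \<Rightarrow> 'a \<Rightarrow> real) \<Rightarrow> bool" where
  "additive_process X \<longleftrightarrow>
     process X \<and> (AE \<omega> in M. X 0 \<omega> = 0) \<and> independent_increments X \<and> stochastically_continuous X"

definition cadlag :: "(real \<Rightarrow> real) \<Rightarrow> bool" where
  "cadlag x \<longleftrightarrow>
     (\<forall>t\<ge>0. (x \<longlongrightarrow> x t) (at_right t)) \<and> (\<forall>t>0. \<exists>l. (x \<longlongrightarrow> l) (at_left t))"

definition Levy_process :: "(real \<Rightarrow> 'a \<Rightarrow> real) \<Rightarrow> bool" where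
  "Levy_process X \<longleftrightarrow>
     additive_process X \<and> stationary_increments X \<and> (AE \<omega> in M. cadlag (\<lambda>t. X t \<omega>))"

definition independent_processes :: "(real \<Rightarrow> 'a \<Rightarrow> real) \<Rightarrow> (real \<Rightarrow> 'a \<Rightarrow> real) \<Rightarrow> bool" where
  "independent_processes X Y \<longleftrightarrow>
     indep_var (\<Pi>\<^sub>M t\<in>{0..}. borel) (\<lambda>\<omega>. \<lambda>t\<in>{0..}. X t \<omega>)
               (\<Pi>\<^sub>M t\<in>{0..}. borel) (\<lambda>\<omega>. \<lambda>t\<in>{0..}. Y t \<omega>)"

text \<open>
  For an additive process \<open>X\<close> and \<open>s \<le> t\<close> this is the conditional expectation of
  \<open>f (X t)\<close> given \<open>X s = x\<close>.
\<close>

definition transition :: "(real \<Rightarrow> 'a \<Rightarrow> real) \<Rightarrow> real \<Rightarrow> real \<Rightarrow> (real \<Rightarrow> complex) \<Rightarrow> real \<Rightarrow> complex" where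
  "transition X s t f x = (\<integral>\<omega>. f (x + (X t \<omega> - X s \<omega>)) \<partial>M)"

end

definition subordinate :: "(real \<Rightarrow> 'a \<Rightarrow> real) \<Rightarrow> (real \<Rightarrow> 'a \<Rightarrow> real) \<Rightarrow> real \<Rightarrow> 'a \<Rightarrow> real" where
  "subordinate S \<Gamma> t \<omega> = S (\<Gamma> t \<omega>) \<omega>"

section \<open>Stable processes and inhomogeneous Gamma subordinators\<close>

text \<open>Both \<open>sgn 0 = 0\<close> and \<open>0 powr \<alpha> = 0\<close> hold, so the value at \<open>\<xi> = 0\<close> is \<open>0\<close>.\<close>

definition psi :: "real \<Rightarrow> real \<Rightarrow> real \<Rightarrow> complex" where
  "psi \<alpha> \<theta> \<xi> = of_real (\<bar>\<xi>\<bar> powr \<alpha>) * exp (\<i> * of_real (sgn \<xi> * pi * \<theta> / 2))"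

context prob_space
begin

definition stable_process :: "real \<Rightarrow> real \<Rightarrow> (real \<Rightarrow> 'a \<Rightarrow> real) \<Rightarrow> bool" where
  "stable_process \<alpha> \<theta> S \<longleftrightarrow>
     Levy_process S \<and>
     (\<forall>t\<ge>0. \<forall>\<xi>. char (distr M borel (S t)) \<xi> = exp (- of_real t * psi \<alpha> \<theta> \<xi>))"

text \<open>\<open>Ln\<close> is the principal branch; its argument below has real part \<open>1\<close>.\<close>

definition inhomogeneous_Gamma_subordinator ::
  "(real \<Rightarrow> real) \<Rightarrow> (real \<Rightarrow> 'a \<Rightarrow> real) \<Rightarrow> bool" where
  "inhomogeneous_Gamma_subordinator b \<Gamma> \<longleftrightarrow>
     additive_process \<Gamma> \<and>
     (AE \<omega> in M. mono_on {0..} (\<lambda>t. \<Gamma> t \<omega>)) \<and>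
     (\<forall>(d::nat) (\<xi> :: nat \<Rightarrow> real) (t :: nat \<Rightarrow> real). (\<forall>j<d. t j \<ge> 0) \<longrightarrow>
        (\<integral>\<omega>. exp (\<i> * of_real (\<Sum>j<d. \<xi> j * \<Gamma> (t j) \<omega>)) \<partial>M) =
        exp (- (LINT s:{0<..}|lborel.
          Ln (1 - \<i> * of_real (b s * (\<Sum>j<d. \<xi> j * indicator {0<..<t j} s))))))"

end

section \<open>Fourier multipliers\<close>

definition Schwartz :: "(real \<Rightarrow> complex) \<Rightarrow> bool" where
  "Schwartz f \<longleftrightarrow>
     (\<exists>D :: nat \<Rightarrow> real \<Rightarrow> complex.
        D 0 = f \<and>
        (\<forall>n x. (D n has_vector_derivative D (Suc n) x) (at x)) \<and>
        (\<forall>m n. bounded (range (\<lambda>x. of_real (x ^ m) * D n x))))"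

definition inverse_fourier :: "(real \<Rightarrow> complex) \<Rightarrow> real \<Rightarrow> complex" where
  "inverse_fourier h x =
     of_real (1 / sqrt (2 * pi)) * (\<integral>\<xi>. exp (\<i> * of_real (\<xi> * x)) * h \<xi> \<partial>lborel)"

definition rapidly_decaying :: "(real \<Rightarrow> complex) \<Rightarrow> bool" where
  "rapidly_decaying h \<longleftrightarrow>
     h \<in> borel_measurable borel \<and> (\<forall>n::nat. bounded (range (\<lambda>\<xi>. of_real (\<xi> ^ n) * h \<xi>)))"

text \<open>
  The multiplier with symbol \<open>m\<close> on its domain, the inverse Fourier transforms of rapidly
  decaying functions. The function \<open>h\<close> is the Fourier transform of \<open>g\<close>; it is determined by \<open>g\<close>
  up to a null set, which does not affect \<open>inverse_fourier (\<lambda>\<xi>. m \<xi> * h \<xi>)\<close>. Outside this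
  domain the value is unspecified.
\<close>

definition fourier_multiplier ::
  "(real \<Rightarrow> complex) \<Rightarrow> (real \<Rightarrow> complex) \<Rightarrow> real \<Rightarrow> complex" where
  "fourier_multiplier m g =
     (THE v. \<exists>h. rapidly_decaying h \<and> g = inverse_fourier h \<and>
        v = inverse_fourier (\<lambda>\<xi>. m \<xi> * h \<xi>))"

text \<open>
  The operator \<open>- ln (1 - \<beta> D)\<close>, where \<open>D\<close> is the adjoint of the Riesz--Feller derivative,
  that is, the multiplier with symbol \<open>- psi \<alpha> \<theta>\<close>.
\<close>

definition P_operator :: "real \<Rightarrow> real \<Rightarrow> real \<Rightarrow> (real \<Rightarrow> complex) \<Rightarrow> real \<Rightarrow> complex" where
  "P_operator \<alpha> \<theta> \<beta> = fourier_multiplier (\<lambda>\<xi>. - Ln (1 + of_real \<beta> * psi \<alpha> \<theta> \<xi>))"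

end

theory Submission
  imports Defs "HOL-Complex_Analysis.Complex_Analysis"
begin

text \<open>
  Conditioning on \<open>\<Gamma>\<close> gives \<open>E exp (\<i> \<xi> (G t - G s)) = E exp (- (\<Gamma> t - \<Gamma> s) \<psi> \<xi>)\<close>, which by analytic
  continuation of the characteristic function of \<open>\<Gamma> t - \<Gamma> s\<close> from the imaginary axis to the right half
  plane equals \<open>exp (- \<integral>\<^sub>s\<^sup>t Ln (1 + b r \<psi> \<xi>) dr)\<close>. By Fourier inversion \<open>u (\<cdot>, t)\<close> is the inverse
  transform of this function times the transform of \<open>f\<close>. Differentiating in \<open>t\<close> under the integral
  sign brings down the symbol \<open>- Ln (1 + b t \<psi> \<xi>)\<close>; the logarithm grows at most polynomially and the
  transform of \<open>f\<close> decays rapidly, which justifies the interchange.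
\<close>

section \<open>Fourier transforms of rapidly decaying functions\<close>

text \<open>Three obstacles shape the proof. The operator is a definite description over all rapidly
  decaying \<open>h\<close> that represent its argument, so it can be evaluated only once the
  inverse transform is known to be injective up to null sets. The independence of \<open>S\<close>
  and \<open>\<Gamma>\<close> concerns the product sigma-algebras on path space, and there
  evaluating one path at a time prescribed by the other is not a measurable operation; conditioning
  is therefore done at times rounded to a grid, and cadlag paths carry the identity to the limit.
  Finally, everything hinges on \<open>psi\<close> taking values in the closed right half plane: the
  bound on \<theta> gives |\<theta>| \<le> min {\<alpha>, 2 - \<alpha>} \<le> 1, so the phase of
  \<open>psi\<close> is at most pi/2. This makes the continued Laplace transform available at
  \<open>psi\<close>, keeps 1 + b \<open>psi\<close> off the branch cut of \<open>Ln\<close>, and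
  bounds the exponentials by 1.\<close>

lemma integrable_lborel_inverse_1_plus_square:
  "integrable lborel (\<lambda>x::real. inverse (1 + x\<^sup>2))"
proof -
  have "einterval (-\<infinity>) \<infinity> = UNIV"
    by (auto simp: einterval_def)
  then show ?thesis
    using integrable_inverse_1_plus_square by (simp add: set_integrable_def)
qed

lemma rapidly_decaying_bound:
  assumes "rapidly_decaying h"
  obtains K where "\<And>\<xi>. norm (h \<xi>) * \<bar>\<xi>\<bar> ^ n \<le> K"
proof -
  obtain K where "\<And>\<xi>. norm (of_real (\<xi> ^ n) * h \<xi>) \<le> K"
    using assms unfolding rapidly_decaying_def bounded_iff by fast
  then show thesis
    by (intro that[of K]) (simp add: norm_mult norm_power mult.commute power_abs)
qed

text \<open>Growth of order \<open>k\<close> costs \<open>k\<close> powers of decay: weight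
  \<open>n\<close> of the product is controlled by the weights \<open>n\<close> and
  \<open>n + k\<close> of \<open>h\<close>.\<close>

lemma rapidly_decaying_mult:
  assumes h: "rapidly_decaying h" and m [measurable]: "m \<in> borel_measurable borel"
    and bound: "\<And>\<xi>. norm (m \<xi>) \<le> C * (1 + \<bar>\<xi>\<bar> ^ k)"
  shows "rapidly_decaying (\<lambda>\<xi>. m \<xi> * h \<xi>)"
  unfolding rapidly_decaying_def
proof safe
  have [measurable]: "h \<in> borel_measurable borel"
    using h by (simp add: rapidly_decaying_def)
  show "(\<lambda>\<xi>. m \<xi> * h \<xi>) \<in> borel_measurable borel"
    by measurable
  fix n :: nat
  obtain K1 where K1: "\<And>\<xi>. norm (h \<xi>) * \<bar>\<xi>\<bar> ^ n \<le> K1"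
    using rapidly_decaying_bound[OF h] by blast
  obtain K2 where K2: "\<And>\<xi>. norm (h \<xi>) * \<bar>\<xi>\<bar> ^ (n + k) \<le> K2"
    using rapidly_decaying_bound[OF h] by blast
  \<comment> \<open>Since \<open>0 ^ k\<close> is 1 for \<open>k = 0\<close> and 0 otherwise, the
    bound at 0 reads \<open>2 * C\<close> or \<open>C\<close>; both force the sign.\<close>
  have C: "0 \<le> C"
    using order_trans[OF norm_ge_zero bound[of 0]] by (cases "k = 0") (auto simp: power_0_left)
  have "norm (of_real (\<xi> ^ n) * (m \<xi> * h \<xi>)) \<le> C * (K1 + K2)" for \<xi> :: real
  proof -
    have "norm (of_real (\<xi> ^ n) * (m \<xi> * h \<xi>)) = norm (m \<xi>) * (norm (h \<xi>) * \<bar>\<xi>\<bar> ^ n)"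
      by (simp add: norm_mult norm_power power_abs)
    also have "\<dots> \<le> (C * (1 + \<bar>\<xi>\<bar> ^ k)) * (norm (h \<xi>) * \<bar>\<xi>\<bar> ^ n)"
      by (intro mult_right_mono bound) auto
    also have "\<dots> = C * (norm (h \<xi>) * \<bar>\<xi>\<bar> ^ n + norm (h \<xi>) * \<bar>\<xi>\<bar> ^ (n + k))"
      by (simp add: algebra_simps power_add)
    also have "\<dots> \<le> C * (K1 + K2)"
      by (intro mult_left_mono add_mono K1 K2 C)
    finally show ?thesis .
  qed
  then show "bounded (range (\<lambda>\<xi>. of_real (\<xi> ^ n) * (m \<xi> * h \<xi>)))"
    by (auto simp: bounded_iff)
qed

lemma integrable_rapidly_decaying:
  assumes h: "rapidly_decaying h"
  shows "integrable lborel h"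
proof -
  have [measurable]: "h \<in> borel_measurable borel"
    using h by (simp add: rapidly_decaying_def)
  obtain K0 where K0: "\<And>\<xi>. norm (h \<xi>) * \<bar>\<xi>\<bar> ^ 0 \<le> K0"
    using rapidly_decaying_bound[OF h] by blast
  obtain K2 where K2: "\<And>\<xi>. norm (h \<xi>) * \<bar>\<xi>\<bar> ^ 2 \<le> K2"
    using rapidly_decaying_bound[OF h] by blast
  show ?thesis
  proof (rule Bochner_Integration.integrable_bound)
    show "integrable lborel (\<lambda>\<xi>. (K0 + K2) * inverse (1 + \<xi>\<^sup>2))"
      using integrable_lborel_inverse_1_plus_square by simp
    show "AE \<xi> in lborel. norm (h \<xi>) \<le> norm ((K0 + K2) * inverse (1 + \<xi>\<^sup>2))"
    proof (intro AE_I2)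
      fix \<xi> :: real
      have "norm (h \<xi>) * (1 + \<xi>\<^sup>2) \<le> K0 + K2"
        using K0[of \<xi>] K2[of \<xi>] by (simp add: algebra_simps)
      moreover have "0 < 1 + \<xi>\<^sup>2"
        by (simp add: add_pos_nonneg)
      ultimately have "norm (h \<xi>) \<le> (K0 + K2) * inverse (1 + \<xi>\<^sup>2)"
        by (simp add: field_simps)
      then show "norm (h \<xi>) \<le> norm ((K0 + K2) * inverse (1 + \<xi>\<^sup>2))"
        by simp
    qed
  qed simp
qed

lemma integrable_exp_ii_mult:
  fixes h :: "real \<Rightarrow> complex"
  assumes "integrable lborel h"
  shows "integrable lborel (\<lambda>\<xi>. exp (\<i> * of_real (\<xi> * x)) * h \<xi>)"
proof -
  note [measurable] = borel_measurable_integrable[OF assms]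
  show ?thesis
    by (rule Bochner_Integration.integrable_bound[OF assms]) (auto simp: norm_mult)
qed

lemma continuous_on_inverse_fourier:
  assumes "integrable lborel h"
  shows "continuous_on UNIV (inverse_fourier h)"
proof -
  note [measurable] = borel_measurable_integrable[OF assms]
  have "(\<lambda>n. inverse_fourier h (X n)) \<longlonglongrightarrow> inverse_fourier h x" if X: "X \<longlonglongrightarrow> x" for X x
    unfolding inverse_fourier_def
  proof (intro tendsto_mult tendsto_const integral_dominated_convergence[where w="\<lambda>\<xi>. norm (h \<xi>)"])
    show "AE \<xi> in lborel. (\<lambda>n. exp (\<i> * of_real (\<xi> * X n)) * h \<xi>) \<longlonglongrightarrow> exp (\<i> * of_real (\<xi> * x)) * h \<xi>"
      by (intro AE_I2 tendsto_intros X)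
  qed (use assms in \<open>auto simp: norm_mult\<close>)
  then show ?thesis
    by (auto simp: continuous_on_sequentially comp_def)
qed

lemma norm_inverse_fourier_le:
  "norm (inverse_fourier h x) \<le> (\<integral>\<xi>. norm (h \<xi>) \<partial>lborel)"
proof -
  have "norm (inverse_fourier h x) = 1 / sqrt (2 * pi) * norm (\<integral>\<xi>. exp (\<i> * of_real (\<xi> * x)) * h \<xi> \<partial>lborel)"
    by (simp add: inverse_fourier_def norm_mult norm_divide)
  also have "\<dots> \<le> 1 * (\<integral>\<xi>. norm (h \<xi>) \<partial>lborel)"
  proof (rule mult_mono)
    show "1 / sqrt (2 * pi) \<le> 1"
      using pi_gt3 by simp
    show "norm (\<integral>\<xi>. exp (\<i> * of_real (\<xi> * x)) * h \<xi> \<partial>lborel) \<le> (\<integral>\<xi>. norm (h \<xi>) \<partial>lborel)"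
      by (rule order_trans[OF integral_norm_bound]) (simp add: norm_mult)
  qed auto
  finally show ?thesis by simp
qed

text \<open>Integration by parts: the derivative of \<open>e * f\<close> has integral 0 over the
  line because |e| = 1 and \<open>f\<close> vanishes at both ends.\<close>

lemma inverse_fourier_derivative:
  assumes d: "\<And>x. (f has_vector_derivative f' x) (at x)"
    and f: "integrable lborel f" "(f \<longlongrightarrow> 0) at_top" "(f \<longlongrightarrow> 0) at_bot"
    and f': "integrable lborel f'" "continuous_on UNIV f'"
  shows "inverse_fourier f' x = - \<i> * of_real x * inverse_fourier f x"
proof -
  define e where "e = (\<lambda>y. exp (\<i> * of_real (y * x)))"
  have e: "(e has_vector_derivative \<i> * of_real x * e y) (at y)" for y
  proof -
    have "((\<lambda>w. exp (\<i> * (w * of_real x))) has_field_derivative \<i> * of_real x * e y) (at (of_real y))"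
      by (auto intro!: derivative_eq_intros simp: e_def)
    from has_vector_derivative_real_field[OF this] show ?thesis
      by (simp add: e_def)
  qed
  have lim: "((\<lambda>y. e y * f y) \<longlongrightarrow> 0) F" if "(f \<longlongrightarrow> 0) F" for F
  proof -
    have "norm (e y * f y) = norm (f y)" for y
      by (simp add: norm_mult e_def)
    then show ?thesis
      using that tendsto_norm_zero_iff[of "\<lambda>y. e y * f y" F] tendsto_norm_zero_iff[of f F] by simp
  qed
  have int: "integrable lborel (\<lambda>y. e y * f y)" "integrable lborel (\<lambda>y. e y * f' y)"
    unfolding e_def by (rule integrable_exp_ii_mult[OF f(1)], rule integrable_exp_ii_mult[OF f'(1)])
  have UNIV: "einterval (-\<infinity>) \<infinity> = UNIV"
    by (auto simp: einterval_def)
  have int2: "integrable lborel (\<lambda>y. \<i> * of_real x * (e y * f y) + e y * f' y)"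
    using int by auto
  have "(LBINT y=-\<infinity>..\<infinity>. \<i> * of_real x * (e y * f y) + e y * f' y) = 0 - 0"
  proof (rule interval_integral_FTC_integrable)
    fix y :: real
    show "((\<lambda>y. e y * f y) has_vector_derivative \<i> * of_real x * (e y * f y) + e y * f' y) (at y)"
      by (rule has_vector_derivative_eq_rhs[OF has_vector_derivative_mult[OF e d]]) (simp add: algebra_simps)
    have "isCont e y" "isCont f y"
      using has_vector_derivative_continuous[OF e] has_vector_derivative_continuous[OF d] by auto
    moreover have "isCont f' y"
      using f' by (simp add: continuous_on_eq_continuous_at)
    ultimately show "isCont (\<lambda>y. \<i> * of_real x * (e y * f y) + e y * f' y) y"
      by (intro continuous_intros)
  next
    show "set_integrable lborel (einterval (-\<infinity>) \<infinity>) (\<lambda>y. \<i> * of_real x * (e y * f y) + e y * f' y)"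
      using int2 by (simp add: UNIV set_integrable_def)
    show "(((\<lambda>y. e y * f y) \<circ> real_of_ereal) \<longlongrightarrow> 0) (at_right (-\<infinity>))"
      "(((\<lambda>y. e y * f y) \<circ> real_of_ereal) \<longlongrightarrow> 0) (at_left \<infinity>)"
      using lim[OF f(2)] lim[OF f(3)] by (simp_all only: ereal_tendsto_simps)
  qed auto
  then have "(\<integral>y. \<i> * of_real x * (e y * f y) + e y * f' y \<partial>lborel) = 0"
    by (simp add: interval_lebesgue_integral_def UNIV set_lebesgue_integral_def)
  then have "\<i> * of_real x * (\<integral>y. e y * f y \<partial>lborel) + (\<integral>y. e y * f' y \<partial>lborel) = 0"
    using int by (subst (asm) Bochner_Integration.integral_add) auto
  then have "(\<integral>y. e y * f' y \<partial>lborel) = - \<i> * of_real x * (\<integral>y. e y * f y \<partial>lborel)"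
    by (simp add: add_eq_0_iff2)
  then show ?thesis
    by (simp add: inverse_fourier_def e_def)
qed

lemma rapidly_decaying_tendsto_0:
  assumes "rapidly_decaying h"
  shows "(h \<longlongrightarrow> 0) at_infinity"
proof -
  obtain K where K: "\<And>\<xi>. norm (h \<xi>) * \<bar>\<xi>\<bar> ^ 1 \<le> K"
    using rapidly_decaying_bound[OF assms] by blast
  have "((\<lambda>\<xi>. K / norm \<xi>) \<longlongrightarrow> 0) at_infinity"
    by (intro tendsto_divide_0[OF tendsto_const] filterlim_at_top_imp_at_infinity filterlim_norm_at_top)
  moreover have "eventually (\<lambda>\<xi>. norm (h \<xi>) \<le> K / norm \<xi>) at_infinity"
    using eventually_not_equal_at_infinity[of 0]
    by eventually_elim (use K in \<open>auto simp: field_simps\<close>)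
  ultimately show ?thesis
    by (rule Lim_null_comparison[rotated])
qed

lemma Schwartz_rapidly_decaying:
  assumes "Schwartz f"
  obtains D where "D 0 = f" "\<And>n x. (D n has_vector_derivative D (Suc n) x) (at x)"
    "\<And>n. continuous_on UNIV (D n)" "\<And>n. rapidly_decaying (D n)"
proof -
  obtain D where D: "D 0 = f" "\<And>n x. (D n has_vector_derivative D (Suc n) x) (at x)"
    "\<And>m n. bounded (range (\<lambda>x. of_real (x ^ m) * D n x))"
    using assms unfolding Schwartz_def by blast
  have cont: "continuous_on UNIV (D n)" for n
    using D(2) by (auto intro!: continuous_at_imp_continuous_on has_vector_derivative_continuous)
  show thesis
    using D(3) by (intro that[OF D(1,2) cont])
      (auto simp: rapidly_decaying_def intro!: borel_measurable_continuous_onI cont)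
qed

text \<open>The reflected inverse transform is the Fourier transform. Up to a factor of modulus 1,
  multiplying it by the \<open>n\<close>-th power of \<xi> yields the transform of the
  \<open>n\<close>-th derivative, which is bounded by the L1 norm of that derivative.\<close>

lemma rapidly_decaying_fourier_Schwartz:
  assumes "Schwartz f"
  shows "rapidly_decaying (\<lambda>\<xi>. inverse_fourier f (- \<xi>))"
proof -
  obtain D where D: "D 0 = f" "\<And>n x. (D n has_vector_derivative D (Suc n) x) (at x)"
    "\<And>n. continuous_on UNIV (D n)" "\<And>n. rapidly_decaying (D n)"
    using Schwartz_rapidly_decaying[OF assms] by blast
  note int = integrable_rapidly_decaying[OF D(4)]
  have lim: "(D n \<longlongrightarrow> 0) at_top" "(D n \<longlongrightarrow> 0) at_bot" for n
    by (rule tendsto_mono[OF at_top_le_at_infinity rapidly_decaying_tendsto_0[OF D(4)]],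
        rule tendsto_mono[OF at_bot_le_at_infinity rapidly_decaying_tendsto_0[OF D(4)]])
  have deriv: "inverse_fourier (D n) x = (- \<i> * of_real x) ^ n * inverse_fourier f x" for n x
    by (induction n) (simp_all add: D(1) inverse_fourier_derivative[OF D(2) int lim int D(3)])
  show ?thesis
    unfolding rapidly_decaying_def
  proof safe
    have "continuous_on UNIV (\<lambda>\<xi>. inverse_fourier f (- \<xi>))"
      using int[of 0] D(1) by (intro continuous_on_compose2[OF continuous_on_inverse_fourier]) (auto intro!: continuous_intros)
    then show "(\<lambda>\<xi>. inverse_fourier f (- \<xi>)) \<in> borel_measurable borel"
      by (rule borel_measurable_continuous_onI)
    fix n
    have "norm (of_real (\<xi> ^ n) * inverse_fourier f (- \<xi>)) \<le> (\<integral>x. norm (D n x) \<partial>lborel)" for \<xi>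
    proof -
      have "norm (of_real (\<xi> ^ n) * inverse_fourier f (- \<xi>)) = norm (inverse_fourier (D n) (- \<xi>))"
        unfolding deriv by (simp add: norm_mult norm_power)
      then show ?thesis
        using norm_inverse_fourier_le by simp
    qed
    then show "bounded (range (\<lambda>\<xi>. of_real (\<xi> ^ n) * inverse_fourier f (- \<xi>)))"
      by (auto simp: bounded_iff)
  qed
qed

section \<open>Fourier inversion\<close>

lemma fourier_multiplication_formula:
  fixes f g :: "real \<Rightarrow> complex"
  assumes f: "integrable lborel f" and g: "integrable lborel g"
  shows "(\<integral>x. inverse_fourier f x * g x \<partial>lborel) = (\<integral>y. f y * inverse_fourier g y \<partial>lborel)"
proof -
  note [measurable] = borel_measurable_integrable[OF f] borel_measurable_integrable[OF g]
  have int: "integrable (lborel \<Otimes>\<^sub>M lborel) (\<lambda>(x, y). exp (\<i> * of_real (y * x)) * f y * g x)"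
  proof (rule Bochner_Integration.integrable_bound)
    show "integrable (lborel \<Otimes>\<^sub>M lborel) (\<lambda>(x, y). norm (f y) * norm (g x))"
    proof (subst lborel_pair.integrable_product_swap_iff[symmetric], rule lborel_pair.Fubini_integrable)
      show "integrable lborel (\<lambda>x. \<integral>y. norm (case (x, y) of (x, y) \<Rightarrow> case (y, x) of (x, y) \<Rightarrow> norm (f y) * norm (g x)) \<partial>lborel)"
        using f g by (simp add: integrable_norm)
      show "AE x in lborel. integrable lborel (\<lambda>y. case (x, y) of (x, y) \<Rightarrow> case (y, x) of (x, y) \<Rightarrow> norm (f y) * norm (g x))"
        using g by (simp add: integrable_norm)
    qed measurable
  qed (auto simp: norm_mult)
  have "(\<integral>x. inverse_fourier f x * g x \<partial>lborel) =
      of_real (1 / sqrt (2 * pi)) * (\<integral>x. (\<integral>y. exp (\<i> * of_real (y * x)) * f y * g x \<partial>lborel) \<partial>lborel)"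
    unfolding inverse_fourier_def integral_mult_left_zero
    by (simp only: mult.assoc integral_mult_right_zero)
  \<comment> \<open>The kernel is symmetric in \<open>x\<close> and \<open>y\<close>, so exchanging
    the integrals moves the transform from \<open>f\<close> to \<open>g\<close>.\<close>
  also have "(\<integral>x. (\<integral>y. exp (\<i> * of_real (y * x)) * f y * g x \<partial>lborel) \<partial>lborel) =
      (\<integral>y. (\<integral>x. exp (\<i> * of_real (y * x)) * f y * g x \<partial>lborel) \<partial>lborel)"
    by (rule lborel_pair.Fubini_integral[OF int, symmetric])
  also have "of_real (1 / sqrt (2 * pi)) * \<dots> = (\<integral>y. f y * inverse_fourier g y \<partial>lborel)"
    by (simp add: inverse_fourier_def mult_ac)
  finally show ?thesis .
qed

text \<open>Rescaling by \<epsilon> reduces the integral to the characteristic function of the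
  standard normal law; the factor 1/sqrt(2 pi) of the inverse transform turns it back into a
  density. The result is an approximate identity centred at \<open>x\<close>, of width
  \<epsilon>.\<close>

lemma inverse_fourier_gaussian:
  assumes "\<epsilon> > 0"
  shows "inverse_fourier (\<lambda>\<xi>. of_real (std_normal_density (\<epsilon> * \<xi>)) * exp (\<i> * of_real (\<xi> * x))) (- y) =
         of_real (std_normal_density ((x - y) / \<epsilon>) / \<epsilon>)"
proof -
  have "(\<integral>\<xi>. exp (\<i> * of_real (\<xi> * - y)) * (of_real (std_normal_density (\<epsilon> * \<xi>)) * exp (\<i> * of_real (\<xi> * x))) \<partial>lborel)
      = (\<integral>\<xi>. std_normal_density (\<epsilon> * \<xi>) *\<^sub>R exp (\<i> * of_real ((x - y) / \<epsilon> * (\<epsilon> * \<xi>))) \<partial>lborel)"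
  proof (intro Bochner_Integration.integral_cong refl)
    fix \<xi>
    have arg: "(x - y) / \<epsilon> * (\<epsilon> * \<xi>) = \<xi> * (- y) + \<xi> * x"
      using assms by (simp add: field_simps)
    show "exp (\<i> * of_real (\<xi> * - y)) * (of_real (std_normal_density (\<epsilon> * \<xi>)) * exp (\<i> * of_real (\<xi> * x))) =
        std_normal_density (\<epsilon> * \<xi>) *\<^sub>R exp (\<i> * of_real ((x - y) / \<epsilon> * (\<epsilon> * \<xi>)))"
      unfolding arg of_real_add distrib_left exp_add scaleR_conv_of_real
      by (simp only: mult_ac)
  qed
  also have "\<dots> = (1 / \<epsilon>) *\<^sub>R (\<integral>\<xi>. std_normal_density \<xi> *\<^sub>R exp (\<i> * of_real ((x - y) / \<epsilon> * \<xi>)) \<partial>lborel)"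
    using assms by (subst (2) lborel_integral_real_affine[where c=\<epsilon> and t=0]) (simp_all add: scaleR_conv_of_real)
  also have "(\<integral>\<xi>. std_normal_density \<xi> *\<^sub>R exp (\<i> * of_real ((x - y) / \<epsilon> * \<xi>)) \<partial>lborel) =
      char std_normal_distribution ((x - y) / \<epsilon>)"
    unfolding char_def by (subst integral_density) auto
  also have "\<dots> = of_real (exp (- ((x - y) / \<epsilon>)\<^sup>2 / 2))"
    by (simp add: char_std_normal_distribution)
  finally show ?thesis
    by (simp add: inverse_fourier_def std_normal_density_def scaleR_conv_of_real power_divide)
qed

text \<open>Fubini cannot be applied directly, since the double integral does not converge
  absolutely. A Gaussian damping factor of width 1/\<epsilon> repairs this, and the damped integral
  \<open>I n\<close> is computed in two ways: as an average of \<open>f\<close> around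
  \<open>x\<close>, which tends to \<open>f x\<close>, and as a perturbation of the inversion
  integral.\<close>

lemma fourier_inversion:
  fixes f :: "real \<Rightarrow> complex"
  assumes f: "integrable lborel f" "continuous_on UNIV f" "bounded (range f)"
    and F: "integrable lborel (\<lambda>\<xi>. inverse_fourier f (- \<xi>))"
  shows "inverse_fourier (\<lambda>\<xi>. inverse_fourier f (- \<xi>)) x = f x"
proof -
  note [measurable] = borel_measurable_integrable[OF f(1)] borel_measurable_integrable[OF F]
  define \<epsilon> where "\<epsilon> n = 1 / real (Suc n)" for n
  have \<epsilon>: "\<epsilon> n > 0" for n by (simp add: \<epsilon>_def)
  have \<epsilon>0: "\<epsilon> \<longlonglongrightarrow> 0" unfolding \<epsilon>_def by (rule LIMSEQ_Suc) (rule lim_1_over_n)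
  define c where "c = 1 / sqrt (2 * pi)"
  have density_le: "std_normal_density y \<le> c" for y
    by (auto simp: std_normal_density_def c_def intro!: divide_right_mono)
  have sndcont: "isCont std_normal_density y" for y
    unfolding std_normal_density_def by (intro continuous_intros) auto
  have density_int: "integrable lborel (\<lambda>y. std_normal_density y)"
    using integrable_normal_density[of 1 0] by simp
  obtain B where B: "\<And>y. norm (f y) \<le> B"
    using f(3) by (auto simp: bounded_iff)
  define I where "I n = (\<integral>\<xi>. inverse_fourier f (- \<xi>) * (of_real (std_normal_density (\<epsilon> n * \<xi>)) * exp (\<i> * of_real (\<xi> * x))) \<partial>lborel)" for n
  have I: "I n = (\<integral>z. std_normal_density z *\<^sub>R f (x + \<epsilon> n * z) \<partial>lborel)" for n
  proof -
    have int: "integrable lborel (\<lambda>\<xi>. of_real (std_normal_density (\<epsilon> n * \<xi>)) * exp (\<i> * of_real (\<xi> * x)))"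
    proof (rule Bochner_Integration.integrable_bound)
      show "integrable lborel (\<lambda>\<xi>. std_normal_density (\<epsilon> n * \<xi>))"
        using lborel_integrable_real_affine[OF density_int, of "\<epsilon> n" 0] \<epsilon>[of n] by simp
    qed (auto simp: norm_mult)
    \<comment> \<open>The reflection of \<xi> brings the integrand into the shape of the
      multiplication formula.\<close>
    have "I n = (\<integral>\<xi>. inverse_fourier f \<xi> * (of_real (std_normal_density (\<epsilon> n * - \<xi>)) * exp (\<i> * of_real (- \<xi> * x))) \<partial>lborel)"
      unfolding I_def by (subst lborel_integral_real_affine[where c="-1" and t=0]) simp_all
    also have "\<dots> = (\<integral>y. f y * inverse_fourier (\<lambda>\<xi>. of_real (std_normal_density (\<epsilon> n * - \<xi>)) * exp (\<i> * of_real (- \<xi> * x))) y \<partial>lborel)"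
      using lborel_integrable_real_affine[OF int, of "-1" 0]
      by (intro fourier_multiplication_formula f) simp
    also have "\<dots> = (\<integral>y. f y * inverse_fourier (\<lambda>\<xi>. of_real (std_normal_density (\<epsilon> n * \<xi>)) * exp (\<i> * of_real (\<xi> * x))) (- y) \<partial>lborel)"
    proof -
      have "inverse_fourier (\<lambda>\<xi>. h (- \<xi>)) y = inverse_fourier h (- y)" for h y
        unfolding inverse_fourier_def
        by (subst lborel_integral_real_affine[where c="-1" and t=0]) simp_all
      from this[of "\<lambda>\<xi>. of_real (std_normal_density (\<epsilon> n * \<xi>)) * exp (\<i> * of_real (\<xi> * x))"]
      show ?thesis by simp
    qed
    also have "\<dots> = (\<integral>y. f y * of_real (std_normal_density ((x - y) / \<epsilon> n) / \<epsilon> n) \<partial>lborel)"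
      unfolding inverse_fourier_gaussian[OF \<epsilon>] ..
    also have "\<dots> = (\<integral>z. std_normal_density z *\<^sub>R f (x + \<epsilon> n * z) \<partial>lborel)"
      using \<epsilon>[of n] by (subst lborel_integral_real_affine[where c="\<epsilon> n" and t=x])
        (simp_all add: scaleR_conv_of_real mult.commute std_normal_density_def flip: integral_scaleR_right)
    finally show ?thesis .
  qed
  have "(\<lambda>n. \<integral>z. std_normal_density z *\<^sub>R f (x + \<epsilon> n * z) \<partial>lborel) \<longlonglongrightarrow>
      (\<integral>z. std_normal_density z *\<^sub>R f x \<partial>lborel)"
  proof (rule integral_dominated_convergence[where w="\<lambda>z. std_normal_density z * B"])
    show "AE z in lborel. (\<lambda>n. std_normal_density z *\<^sub>R f (x + \<epsilon> n * z)) \<longlonglongrightarrow> std_normal_density z *\<^sub>R f x"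
    proof (intro AE_I2 tendsto_scaleR tendsto_const)
      fix z
      have "(\<lambda>n. x + \<epsilon> n * z) \<longlonglongrightarrow> x + 0 * z"
        by (intro tendsto_intros \<epsilon>0)
      moreover have "isCont f x"
        using f(2) by (simp add: continuous_on_eq_continuous_at)
      ultimately show "(\<lambda>n. f (x + \<epsilon> n * z)) \<longlonglongrightarrow> f x"
        using isCont_tendsto_compose[of x f] by simp
    qed
  qed (use density_int B in \<open>auto intro!: mult_left_mono simp: norm_mult\<close>)
  also have "(\<integral>z. std_normal_density z *\<^sub>R f x \<partial>lborel) = f x"
    using integral_normal_density[of 1 0] by simp
  finally have lim1: "I \<longlonglongrightarrow> f x"
    by (simp add: I[abs_def])
  have "I \<longlonglongrightarrow> (\<integral>\<xi>. inverse_fourier f (- \<xi>) * (of_real (std_normal_density 0) * exp (\<i> * of_real (\<xi> * x))) \<partial>lborel)"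
    unfolding I_def
  proof (rule integral_dominated_convergence[where w="\<lambda>\<xi>. norm (inverse_fourier f (- \<xi>)) * c"])
    show "AE \<xi> in lborel. (\<lambda>n. inverse_fourier f (- \<xi>) * (of_real (std_normal_density (\<epsilon> n * \<xi>)) * exp (\<i> * of_real (\<xi> * x))))
        \<longlonglongrightarrow> inverse_fourier f (- \<xi>) * (of_real (std_normal_density 0) * exp (\<i> * of_real (\<xi> * x)))"
    proof (intro AE_I2 tendsto_mult tendsto_const tendsto_of_real)
      fix \<xi>
      have "(\<lambda>n. \<epsilon> n * \<xi>) \<longlonglongrightarrow> 0 * \<xi>"
        by (intro tendsto_intros \<epsilon>0)
      then show "(\<lambda>n. std_normal_density (\<epsilon> n * \<xi>)) \<longlonglongrightarrow> std_normal_density 0"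
        using isCont_tendsto_compose[OF sndcont] by fastforce
    qed
  qed (use F density_le in \<open>auto intro!: mult_left_mono simp: norm_mult\<close>)
  \<comment> \<open>\<open>std_normal_density 0\<close> equals 1/sqrt(2 pi), exactly the normalising
    constant of the outer inverse transform.\<close>
  also have "(\<integral>\<xi>. inverse_fourier f (- \<xi>) * (of_real (std_normal_density 0) * exp (\<i> * of_real (\<xi> * x))) \<partial>lborel)
      = inverse_fourier (\<lambda>\<xi>. inverse_fourier f (- \<xi>)) x"
    unfolding inverse_fourier_def[of "\<lambda>\<xi>. inverse_fourier f (- \<xi>)" x]
    by (subst integral_mult_right_zero[symmetric], intro Bochner_Integration.integral_cong refl)
      (simp add: std_normal_density_def)
  finally have lim2: "I \<longlonglongrightarrow> inverse_fourier (\<lambda>\<xi>. inverse_fourier f (- \<xi>)) x" .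
  show ?thesis
    by (rule LIMSEQ_unique[OF lim2 lim1])
qed

lemma fourier_inversion_Schwartz:
  assumes "Schwartz f"
  shows "inverse_fourier (\<lambda>\<xi>. inverse_fourier f (- \<xi>)) = f"
proof
  fix x
  obtain D :: "nat \<Rightarrow> real \<Rightarrow> complex" where D: "D 0 = f" "\<And>n. continuous_on UNIV (D n)" "\<And>n. rapidly_decaying (D n)"
    using Schwartz_rapidly_decaying[OF assms] by blast
  obtain B where "norm (f y) \<le> B" for y
    using rapidly_decaying_bound[OF D(3)[of 0], of 0] by (auto simp: D(1))
  then show "inverse_fourier (\<lambda>\<xi>. inverse_fourier f (- \<xi>)) x = f x"
    using D(1) D(2)[of 0] integrable_rapidly_decaying[OF D(3)[of 0]]
      integrable_rapidly_decaying[OF rapidly_decaying_fourier_Schwartz[OF assms]]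
    by (intro fourier_inversion) (auto simp: bounded_iff)
qed

section \<open>Uniqueness of the Fourier transform and evaluation of multipliers\<close>

text \<open>
  The positive and negative parts of a function with vanishing transform have equal mass, so
  after normalisation Levy's uniqueness theorem applies to them.
\<close>

lemma AE_eq_0_if_fourier_eq_0_real:
  fixes h :: "real \<Rightarrow> real"
  assumes h: "integrable lborel h"
    and 0: "\<And>x. (\<integral>\<xi>. exp (\<i> * of_real (\<xi> * x)) * of_real (h \<xi>) \<partial>lborel) = 0"
  shows "AE \<xi> in lborel. h \<xi> = 0"
proof -
  note [measurable] = borel_measurable_integrable[OF h]
  define p n where "p \<xi> = max 0 (h \<xi>)" and "n \<xi> = max 0 (- h \<xi>)" for \<xi>
  have [measurable]: "p \<in> borel_measurable borel" "n \<in> borel_measurable borel"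
    unfolding p_def n_def by measurable
  have int: "integrable lborel p" "integrable lborel n"
    unfolding p_def n_def using h by auto
  have nonneg: "0 \<le> p \<xi>" "0 \<le> n \<xi>" for \<xi>
    by (auto simp: p_def n_def)
  have h_eq: "h \<xi> = p \<xi> - n \<xi>" for \<xi>
    by (auto simp: p_def n_def)
  have eint: "integrable lborel (\<lambda>\<xi>. exp (\<i> * of_real (\<xi> * x)) * of_real (q \<xi>))"
    if "integrable lborel q" for q :: "real \<Rightarrow> real" and x
    using that by (intro integrable_exp_ii_mult) simp
  have eq: "(\<integral>\<xi>. exp (\<i> * of_real (\<xi> * x)) * of_real (p \<xi>) \<partial>lborel) =
      (\<integral>\<xi>. exp (\<i> * of_real (\<xi> * x)) * of_real (n \<xi>) \<partial>lborel)" for x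
  proof -
    have "(\<integral>\<xi>. exp (\<i> * of_real (\<xi> * x)) * of_real (p \<xi>) - exp (\<i> * of_real (\<xi> * x)) * of_real (n \<xi>) \<partial>lborel) = 0"
      using 0[of x] by (simp add: h_eq algebra_simps)
    then show ?thesis
      by (subst (asm) Bochner_Integration.integral_diff) (use eint[OF int(1)] eint[OF int(2)] in auto)
  qed
  define c where "c = (\<integral>\<xi>. p \<xi> \<partial>lborel)"
  \<comment> \<open>At \<open>x = 0\<close> the equality of transforms says that both parts have the
    same mass.\<close>
  have c_n: "(\<integral>\<xi>. n \<xi> \<partial>lborel) = c"
  proof -
    have "complex_of_real (\<integral>\<xi>. n \<xi> \<partial>lborel) = of_real c"
      using eq[of 0] by (simp add: c_def)
    then show ?thesis by (simp only: of_real_eq_iff)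
  qed
  have "c \<ge> 0" unfolding c_def by (intro integral_nonneg_AE) (auto simp: nonneg)
  have nn: "(\<integral>\<^sup>+\<xi>. ennreal (p \<xi>) \<partial>lborel) = ennreal c" "(\<integral>\<^sup>+\<xi>. ennreal (n \<xi>) \<partial>lborel) = ennreal c"
    using int nonneg by (auto simp: nn_integral_eq_integral c_n c_def)
  have "AE \<xi> in lborel. p \<xi> = n \<xi>"
  \<comment> \<open>Normalisation needs positive mass; with mass 0 both parts vanish almost
    everywhere.\<close>
  proof (cases "c = 0")
    case True
    then have "AE \<xi> in lborel. ennreal (p \<xi>) = 0" "AE \<xi> in lborel. ennreal (n \<xi>) = 0"
      using nn by (auto simp: nn_integral_0_iff_AE)
    then show ?thesis
      by eventually_elim (metis nonneg ennreal_eq_0_iff order_antisym)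
  next
    case False
    with \<open>c \<ge> 0\<close> have c: "c > 0" by simp
    define \<mu> where "\<mu> q = density lborel (\<lambda>\<xi>. ennreal (q \<xi> / c))" for q :: "real \<Rightarrow> real"
    have dist: "real_distribution (\<mu> q)"
      if [measurable]: "q \<in> borel_measurable borel" and "\<And>\<xi>. 0 \<le> q \<xi>" "(\<integral>\<^sup>+\<xi>. ennreal (q \<xi>) \<partial>lborel) = ennreal c" for q
    proof -
      have "(\<integral>\<^sup>+\<xi>. ennreal (q \<xi> / c) \<partial>lborel) = (\<integral>\<^sup>+\<xi>. ennreal (1 / c) * ennreal (q \<xi>) \<partial>lborel)"
        using c that by (intro nn_integral_cong) (simp flip: ennreal_mult)
      also have "\<dots> = ennreal (1 / c) * ennreal c"
        using that by (simp add: nn_integral_cmult)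
      also have "\<dots> = 1"
        using c by (simp flip: ennreal_mult)
      finally have "prob_space (\<mu> q)"
        by (intro prob_spaceI) (simp add: \<mu>_def emeasure_density)
      then show ?thesis
        by (auto simp: real_distribution_def real_distribution_axioms_def \<mu>_def)
    qed
    have char: "char (\<mu> q) x = (\<integral>\<xi>. exp (\<i> * of_real (\<xi> * x)) * of_real (q \<xi>) \<partial>lborel) / of_real c"
      if [measurable]: "q \<in> borel_measurable borel" and "\<And>\<xi>. 0 \<le> q \<xi>" for q x
    proof -
      have "char (\<mu> q) x = (\<integral>\<xi>. exp (\<i> * of_real (\<xi> * x)) * of_real (q \<xi>) / of_real c \<partial>lborel)"
        unfolding char_def \<mu>_def using that c
        by (subst integral_density) (auto simp: scaleR_conv_of_real mult_ac)
      then show ?thesis by simp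
    qed
    have "\<mu> p = \<mu> n"
    proof (intro Levy_uniqueness dist ext)
      show "char (\<mu> p) x = char (\<mu> n) x" for x
        by (subst (1 2) char) (simp_all only: eq nonneg, measurable)
    qed (use nn nonneg in auto)
    then have "AE \<xi> in lborel. ennreal (p \<xi> / c) = ennreal (n \<xi> / c)"
      unfolding \<mu>_def by (intro sigma_finite_measure.density_unique_iff[THEN iffD1]) (auto simp: lborel.sigma_finite_measure_axioms)
    then show ?thesis
      by eventually_elim (use c nonneg in \<open>simp\<close>)
  qed
  then show ?thesis
    by eventually_elim (simp add: h_eq)
qed

text \<open>The transform of \<open>cnj k\<close> at \<open>x\<close> is the conjugate of that of
  \<open>k\<close> at \<open>- x\<close>. Hence both vanish, and so do the transforms of their
  combinations \<open>Re k\<close> and \<open>Im k\<close>, to which the real case applies.\<close>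

lemma AE_eq_if_inverse_fourier_eq:
  assumes g: "integrable lborel g" and h: "integrable lborel h"
    and eq: "inverse_fourier g = inverse_fourier h"
  shows "AE \<xi> in lborel. g \<xi> = h \<xi>"
proof -
  define k where "k \<xi> = g \<xi> - h \<xi>" for \<xi>
  have k: "integrable lborel k"
    unfolding k_def using g h by auto
  have 0: "(\<integral>\<xi>. exp (\<i> * of_real (\<xi> * x)) * k \<xi> \<partial>lborel) = 0" for x
  proof -
    have "(\<integral>\<xi>. exp (\<i> * of_real (\<xi> * x)) * g \<xi> \<partial>lborel) = (\<integral>\<xi>. exp (\<i> * of_real (\<xi> * x)) * h \<xi> \<partial>lborel)"
      using fun_cong[OF eq, of x] by (simp add: inverse_fourier_def)
    then show ?thesis
      unfolding k_def right_diff_distrib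
      by (subst Bochner_Integration.integral_diff[OF integrable_exp_ii_mult[OF g] integrable_exp_ii_mult[OF h]]) simp
  qed
  have cnj0: "(\<integral>\<xi>. exp (\<i> * of_real (\<xi> * x)) * cnj (k \<xi>) \<partial>lborel) = 0" for x
  proof -
    have "(\<integral>\<xi>. exp (\<i> * of_real (\<xi> * x)) * cnj (k \<xi>) \<partial>lborel) =
        (\<integral>\<xi>. cnj (exp (\<i> * of_real (\<xi> * - x)) * k \<xi>) \<partial>lborel)"
      by (simp add: exp_cnj)
    then show ?thesis
      using 0[of "- x"] by (simp only: Bochner_Integration.integral_cnj complex_cnj_zero)
  qed
  have cnjk: "integrable lborel (\<lambda>\<xi>. cnj (k \<xi>))"
    using k by simp
  have Re: "AE \<xi> in lborel. Re (k \<xi>) = 0"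
  proof (rule AE_eq_0_if_fourier_eq_0_real)
    fix x
    have "exp (\<i> * of_real (\<xi> * x)) * of_real (Re (k \<xi>)) =
        (exp (\<i> * of_real (\<xi> * x)) * k \<xi> + exp (\<i> * of_real (\<xi> * x)) * cnj (k \<xi>)) / 2" for \<xi>
      unfolding distrib_left[symmetric] complex_add_cnj by simp
    then show "(\<integral>\<xi>. exp (\<i> * of_real (\<xi> * x)) * of_real (Re (k \<xi>)) \<partial>lborel) = 0"
      by (simp only: integral_divide_zero 0 cnj0
          Bochner_Integration.integral_add[OF integrable_exp_ii_mult[OF k] integrable_exp_ii_mult[OF cnjk]]) simp
  qed (use k in auto)
  have Im: "AE \<xi> in lborel. Im (k \<xi>) = 0"
  proof (rule AE_eq_0_if_fourier_eq_0_real)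
    fix x
    have "exp (\<i> * of_real (\<xi> * x)) * of_real (Im (k \<xi>)) =
        (exp (\<i> * of_real (\<xi> * x)) * k \<xi> - exp (\<i> * of_real (\<xi> * x)) * cnj (k \<xi>)) / (2 * \<i>)" for \<xi>
      unfolding right_diff_distrib[symmetric] complex_diff_cnj by (simp add: field_simps)
    then show "(\<integral>\<xi>. exp (\<i> * of_real (\<xi> * x)) * of_real (Im (k \<xi>)) \<partial>lborel) = 0"
      by (simp only: integral_divide_zero 0 cnj0
          Bochner_Integration.integral_diff[OF integrable_exp_ii_mult[OF k] integrable_exp_ii_mult[OF cnjk]]) simp
  qed (use k in auto)
  from Re Im show ?thesis
    by eventually_elim (simp add: k_def complex_eq_iff)
qed

text \<open>Two admissible choices of \<open>h\<close> agree almost everywhere, and an integral does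
  not see the difference; thus the description denotes a single function, equal at every
  point.\<close>

lemma fourier_multiplier_inverse_fourier:
  assumes h: "rapidly_decaying h" and m [measurable]: "m \<in> borel_measurable borel"
  shows "fourier_multiplier m (inverse_fourier h) = inverse_fourier (\<lambda>\<xi>. m \<xi> * h \<xi>)"
  unfolding fourier_multiplier_def
proof (rule the_equality)
  fix v
  assume "\<exists>h'. rapidly_decaying h' \<and> inverse_fourier h = inverse_fourier h' \<and>
    v = inverse_fourier (\<lambda>\<xi>. m \<xi> * h' \<xi>)"
  then obtain h' where h': "rapidly_decaying h'" "inverse_fourier h = inverse_fourier h'"
    and v: "v = inverse_fourier (\<lambda>\<xi>. m \<xi> * h' \<xi>)" by blast
  have [measurable]: "h \<in> borel_measurable borel" "h' \<in> borel_measurable borel"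
    using h h' by (auto simp: rapidly_decaying_def)
  have "AE \<xi> in lborel. h \<xi> = h' \<xi>"
    using h h' by (intro AE_eq_if_inverse_fourier_eq integrable_rapidly_decaying)
  then show "v = inverse_fourier (\<lambda>\<xi>. m \<xi> * h \<xi>)"
    unfolding v inverse_fourier_def
    by (intro ext arg_cong2[where f="(*)"] refl integral_cong_AE) auto
qed (use h in blast)

section \<open>The Laplace transform of the Gamma subordinator\<close>

text \<open>Dominated convergence along sequences: the mean value inequality on the convex set
  bounds the increment of \<open>f\<close>, so the remainder quotient is dominated by
  \<open>2 * w\<close>. A general convex \<open>C\<close> in a normed space lets one lemma serve
  both the complex argument of a Laplace transform and the time variable on the half-line
  \<open>{s..}\<close>.\<close>

lemma has_derivative_lebesgue_integral:
  fixes f :: "'p::real_normed_vector \<Rightarrow> 'a \<Rightarrow> 'b::{banach, second_countable_topology}"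
  assumes C: "convex C" "x0 \<in> C"
    and int: "\<And>x. x \<in> C \<Longrightarrow> integrable M (f x)"
    and d: "\<And>x \<omega>. x \<in> C \<Longrightarrow> \<omega> \<in> space M \<Longrightarrow> ((\<lambda>x. f x \<omega>) has_derivative f' x \<omega>) (at x within C)"
    and bound: "\<And>x \<omega>. x \<in> C \<Longrightarrow> \<omega> \<in> space M \<Longrightarrow> onorm (f' x \<omega>) \<le> w \<omega>"
    and w: "integrable M w"
    and meas: "\<And>h. (\<lambda>\<omega>. f' x0 \<omega> h) \<in> borel_measurable M"
  shows "((\<lambda>x. \<integral>\<omega>. f x \<omega> \<partial>M) has_derivative (\<lambda>h. \<integral>\<omega>. f' x0 \<omega> h \<partial>M)) (at x0 within C)"
proof -
  note [measurable] = borel_measurable_integrable[OF int] meas borel_measurable_integrable[OF w]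
  have bl: "bounded_linear (f' x0 \<omega>)" if "\<omega> \<in> space M" for \<omega>
    using d[OF C(2) that] by (rule has_derivative_bounded_linear)
  have le: "norm (f' x0 \<omega> h) \<le> w \<omega> * norm h" if "\<omega> \<in> space M" for \<omega> h
    using onorm[OF bl[OF that], of h] mult_right_mono[OF bound[OF C(2) that] norm_ge_zero[of h]] by simp
  have w0: "0 \<le> w \<omega>" if "\<omega> \<in> space M" for \<omega>
    using onorm_pos_le[OF bl[OF that]] bound[OF C(2) that] by simp
  have int': "integrable M (\<lambda>\<omega>. f' x0 \<omega> h)" for h
    by (rule Bochner_Integration.integrable_bound[where f="\<lambda>\<omega>. w \<omega> * norm h"])
      (use w w0 le in \<open>auto intro!: AE_I2\<close>)
  have lin: "bounded_linear (\<lambda>h. \<integral>\<omega>. f' x0 \<omega> h \<partial>M)"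
  proof (rule bounded_linear_intro)
    show "(\<integral>\<omega>. f' x0 \<omega> (h + k) \<partial>M) = (\<integral>\<omega>. f' x0 \<omega> h \<partial>M) + (\<integral>\<omega>. f' x0 \<omega> k \<partial>M)" for h k
      by (subst Bochner_Integration.integral_add[OF int' int', symmetric], rule Bochner_Integration.integral_cong)
        (auto simp: linear_add bounded_linear.linear[OF bl])
    show "(\<integral>\<omega>. f' x0 \<omega> (r *\<^sub>R h) \<partial>M) = r *\<^sub>R (\<integral>\<omega>. f' x0 \<omega> h \<partial>M)" for r h
      by (subst integral_scaleR_right[symmetric], rule Bochner_Integration.integral_cong)
        (auto simp: linear_scale bounded_linear.linear[OF bl])
    show "norm (\<integral>\<omega>. f' x0 \<omega> h \<partial>M) \<le> norm h * (\<integral>\<omega>. w \<omega> \<partial>M)" for h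
    proof -
      have "norm (\<integral>\<omega>. f' x0 \<omega> h \<partial>M) \<le> (\<integral>\<omega>. norm (f' x0 \<omega> h) \<partial>M)"
        by (rule integral_norm_bound)
      also have "\<dots> \<le> (\<integral>\<omega>. w \<omega> * norm h \<partial>M)"
        using int' w le by (intro integral_mono) auto
      finally show ?thesis by (simp add: mult.commute)
    qed
  qed
  show ?thesis
    unfolding has_derivative_within tendsto_at_iff_sequentially
  proof (intro conjI lin allI impI)
    fix X assume X: "\<forall>i. X i \<in> C - {x0}" and lim: "X \<longlonglongrightarrow> x0"
    \<comment> \<open>The remainder quotient in the definition of the Frechet derivative, for a
      single \<omega>.\<close>
    define q where "q i \<omega> = (1 / norm (X i - x0)) *\<^sub>R (f (X i) \<omega> - (f x0 \<omega> + f' x0 \<omega> (X i - x0)))" for i \<omega>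
    have XC: "X i \<in> C" for i
      using X by auto
    have [measurable]: "q i \<in> borel_measurable M" for i
      using XC C unfolding q_def by measurable
    have "(\<lambda>i. \<integral>\<omega>. q i \<omega> \<partial>M) \<longlonglongrightarrow> (\<integral>\<omega>. 0 \<partial>M)"
    proof (rule integral_dominated_convergence[where w="\<lambda>\<omega>. 2 * w \<omega>"])
      show "AE \<omega> in M. (\<lambda>i. q i \<omega>) \<longlonglongrightarrow> 0"
      proof (rule AE_I2)
        fix \<omega> assume "\<omega> \<in> space M"
        from d[OF C(2) this] show "(\<lambda>i. q i \<omega>) \<longlonglongrightarrow> 0"
          using X lim unfolding has_derivative_within tendsto_at_iff_sequentially q_def comp_def by blast
      qed
      show "AE \<omega> in M. norm (q i \<omega>) \<le> 2 * w \<omega>" for i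
      proof (rule AE_I2)
        fix \<omega> assume \<omega>: "\<omega> \<in> space M"
        have "norm (f (X i) \<omega> - f x0 \<omega>) \<le> w \<omega> * norm (X i - x0)"
          using differentiable_bound[OF C(1) d[OF _ \<omega>] bound[OF _ \<omega>] XC[of i] C(2)] by auto
        moreover have "norm (f' x0 \<omega> (X i - x0)) \<le> w \<omega> * norm (X i - x0)"
          by (rule le[OF \<omega>])
        ultimately have "norm (f (X i) \<omega> - (f x0 \<omega> + f' x0 \<omega> (X i - x0))) \<le> 2 * w \<omega> * norm (X i - x0)"
          using norm_triangle_ineq4[of "f (X i) \<omega> - f x0 \<omega>" "f' x0 \<omega> (X i - x0)"] by (simp add: algebra_simps)
        moreover have "norm (X i - x0) > 0"
          using X by simp
        ultimately show "norm (q i \<omega>) \<le> 2 * w \<omega>"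
          unfolding q_def norm_scaleR by (simp add: pos_divide_le_eq)
      qed
    qed (use w in auto)
    moreover have "(\<integral>\<omega>. q i \<omega> \<partial>M) = (1 / norm (X i - x0)) *\<^sub>R
        ((\<integral>\<omega>. f (X i) \<omega> \<partial>M) - ((\<integral>\<omega>. f x0 \<omega> \<partial>M) + (\<integral>\<omega>. f' x0 \<omega> (X i - x0) \<partial>M)))" for i
      unfolding q_def integral_scaleR_right using int[OF XC] int[OF C(2)] int' by simp
    ultimately show "((\<lambda>y. (1 / norm (y - x0)) *\<^sub>R ((\<integral>\<omega>. f y \<omega> \<partial>M) -
        ((\<integral>\<omega>. f x0 \<omega> \<partial>M) + (\<integral>\<omega>. f' x0 \<omega> (y - x0) \<partial>M)))) \<circ> X) \<longlonglongrightarrow> 0"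
      by (simp add: comp_def)
  qed
qed

text \<open>
  The difference, extended by \<open>0\<close> to the left half plane, is continuous and holomorphic off the
  imaginary axis, hence entire.
\<close>

lemma eq_on_right_half_plane:
  assumes cont: "continuous_on {z. 0 \<le> Re z} f" "continuous_on {z. 0 \<le> Re z} g"
    and hol: "f holomorphic_on {z. 0 < Re z}" "g holomorphic_on {z. 0 < Re z}"
    and eq: "\<And>z. Re z = 0 \<Longrightarrow> f z = g z" and z: "0 \<le> Re z"
  shows "f z = g z"
proof -
  define h where "h = (\<lambda>z. if 0 \<le> Re z then f z - g z else 0)"
  have "continuous_on ({z. 0 \<le> Re z} \<union> {z. Re z \<le> 0}) h"
    unfolding h_def
  proof (rule continuous_on_If)
    show "closed {z. 0 \<le> Re z}" "closed {z. Re z \<le> 0}"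
      by (auto simp: closed_halfspace_Re_ge closed_halfspace_Re_le)
  qed (use cont eq in \<open>auto intro!: continuous_intros\<close>)
  moreover have "{z. 0 \<le> Re z} \<union> {z. Re z \<le> 0} = UNIV"
    by auto
  moreover have "h holomorphic_on {z. 0 < Re z}"
    by (rule holomorphic_transform[OF holomorphic_on_diff[OF hol]]) (simp add: h_def)
  moreover have "h holomorphic_on {z. Re z < 0}"
    by (rule holomorphic_transform[OF holomorphic_on_const[of 0]]) (simp add: h_def)
  \<comment> \<open>The inner product with 1 is the real part, so the parameters 1 and 0 describe
    the imaginary axis.\<close>
  ultimately have "h holomorphic_on UNIV"
    by (intro holomorphic_on_paste_across_line[of UNIV 1 h 0]) (auto simp: inner_complex_def)
  then have "h z = 0"
    by (intro analytic_continuation_open[of "{z. Re z < 0}" UNIV h "\<lambda>_. 0" z])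
      (auto simp: h_def open_halfspace_Re_lt intro!: exI[of _ "-1"])
  then show ?thesis
    using z by (simp add: h_def)
qed

context prob_space
begin

text \<open>Away from the axis the derivative is bounded without any moment of \<open>X\<close>: x
  exp (- x \<delta>) \<le> 1/\<delta> for x \<ge> 0, and constants are integrable on a probability
  space.\<close>

lemma laplace_holomorphic:
  assumes [measurable]: "random_variable borel X" and X: "\<And>\<omega>. 0 \<le> X \<omega>"
  shows "(\<lambda>z. \<integral>\<omega>. exp (- of_real (X \<omega>) * z) \<partial>M) holomorphic_on {z. 0 < Re z}"
proof -
  have "\<exists>D. ((\<lambda>z. \<integral>\<omega>. exp (- of_real (X \<omega>) * z) \<partial>M) has_field_derivative D) (at z0)"
    if z0: "0 < Re z0" for z0
  proof -
    \<comment> \<open>This bound degenerates at the axis, so a half plane that stays away from it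
      and still contains \<open>z0\<close> is used.\<close>
    define \<delta> where "\<delta> = Re z0 / 2"
    have \<delta>: "0 < \<delta>" "\<delta> < Re z0"
      using z0 by (auto simp: \<delta>_def)
    let ?C = "{z. \<delta> < Re z}"
    have "((\<lambda>z. \<integral>\<omega>. exp (- of_real (X \<omega>) * z) \<partial>M) has_derivative
        (\<lambda>h. \<integral>\<omega>. - of_real (X \<omega>) * exp (- of_real (X \<omega>) * z0) * h \<partial>M)) (at z0 within ?C)"
    proof (rule has_derivative_lebesgue_integral[where w="\<lambda>_. 1 / \<delta>"
          and f'="\<lambda>z \<omega> h. - of_real (X \<omega>) * exp (- of_real (X \<omega>) * z) * h"])
      show "convex ?C" by (rule convex_halfspace_Re_gt)
      show "integrable M (\<lambda>\<omega>. exp (- of_real (X \<omega>) * z))" if "z \<in> ?C" for z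
        using that X \<delta> by (intro integrable_const_bound[where B=1]) auto
      fix z \<omega> assume z: "z \<in> ?C"
      have "((\<lambda>z. exp (- of_real (X \<omega>) * z)) has_field_derivative - of_real (X \<omega>) * exp (- of_real (X \<omega>) * z)) (at z within ?C)"
        by (auto intro!: derivative_eq_intros)
      then show "((\<lambda>z. exp (- of_real (X \<omega>) * z)) has_derivative
          (\<lambda>h. - of_real (X \<omega>) * exp (- of_real (X \<omega>) * z) * h)) (at z within ?C)"
        by (simp only: has_field_derivative_def)
      show "onorm (\<lambda>h. - of_real (X \<omega>) * exp (- of_real (X \<omega>) * z) * h) \<le> 1 / \<delta>"
      proof (rule onorm_bound)
        fix h
        have "X \<omega> * exp (- X \<omega> * Re z) \<le> X \<omega> * exp (- X \<omega> * \<delta>)"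
          using X z by (intro mult_left_mono) (auto intro!: mult_left_mono)
        also have "\<dots> = X \<omega> / exp (X \<omega> * \<delta>)"
          by (simp add: exp_minus field_simps)
        also have "\<dots> \<le> 1 / \<delta>"
        proof -
          have "X \<omega> * \<delta> \<le> exp (X \<omega> * \<delta>)"
            using exp_ge_add_one_self[of "X \<omega> * \<delta>"] by linarith
          then show ?thesis
            using \<delta> by (simp add: field_simps)
        qed
        finally show "norm (- of_real (X \<omega>) * exp (- of_real (X \<omega>) * z) * h) \<le> 1 / \<delta> * norm h"
          using X mult_right_mono[of _ _ "norm h"] by (fastforce simp: norm_mult)
      qed (use \<delta> in auto)
    qed (use \<delta> in auto)
    then have "((\<lambda>z. \<integral>\<omega>. exp (- of_real (X \<omega>) * z) \<partial>M) has_field_derivative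
        (\<integral>\<omega>. - of_real (X \<omega>) * exp (- of_real (X \<omega>) * z0) \<partial>M)) (at z0 within ?C)"
      by (simp only: has_field_derivative_def integral_mult_left_zero)
    then show ?thesis
      using \<delta> by (auto simp only: at_within_open[OF _ open_halfspace_Re_gt] mem_Collect_eq)
  qed
  then show ?thesis
    by (subst holomorphic_on_open) (auto simp: open_halfspace_Re_gt)
qed

text \<open>On the closed half plane the exponentials have modulus at most 1. On the axis itself a
  derivative may fail to exist, but pasting across it asks only for continuity.\<close>

lemma laplace_continuous:
  assumes [measurable]: "random_variable borel X" and X: "\<And>\<omega>. 0 \<le> X \<omega>"
  shows "continuous_on {z. 0 \<le> Re z} (\<lambda>z. \<integral>\<omega>. exp (- of_real (X \<omega>) * z) \<partial>M)"
  unfolding continuous_on_sequentially comp_def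
proof safe
  fix x and a :: complex assume x: "\<forall>n. x n \<in> {z. 0 \<le> Re z}" "x \<longlonglongrightarrow> a"
  show "(\<lambda>n. \<integral>\<omega>. exp (- of_real (X \<omega>) * x n) \<partial>M) \<longlonglongrightarrow> (\<integral>\<omega>. exp (- of_real (X \<omega>) * a) \<partial>M)"
    by (rule integral_dominated_convergence[where w="\<lambda>_. 1"]) (use x X in \<open>auto intro!: tendsto_intros AE_I2\<close>)
qed

end

text \<open>The margin opens a half plane reaching beyond the imaginary axis on which
  \<open>Ln (1 + \<beta> z)\<close> stays off the branch cut for all \<beta> \<le> B at once;
  \<open>B + 1\<close> in place of \<open>B\<close> avoids a zero denominator.\<close>

lemma Re_one_plus_mult_pos:
  fixes \<beta> B :: real
  assumes "0 \<le> \<beta>" "\<beta> \<le> B" "- 1 / (B + 1) < Re z"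
  shows "0 < Re (1 + of_real \<beta> * z)"
proof -
  have "- 1 < (B + 1) * Re z"
    using assms by (simp add: field_simps)
  have "- 1 < \<beta> * Re z"
  proof (cases "0 \<le> Re z")
    case True
    then have "0 \<le> \<beta> * Re z" using assms by simp
    then show ?thesis by linarith
  next
    case False
    then have "(B + 1) * Re z \<le> \<beta> * Re z"
      using assms by (intro mult_right_mono_neg) auto
    then show ?thesis
      using \<open>- 1 < (B + 1) * Re z\<close> by linarith
  qed
  then show ?thesis by simp
qed

text \<open>Holomorphy on an open half plane that contains the imaginary axis supplies continuity up
  to the axis and holomorphy inside in one stroke.\<close>

lemma integral_Ln_holomorphic:
  fixes b :: "real \<Rightarrow> real"
  assumes b: "continuous_on {s..t} b" "\<And>r. r \<in> {s..t} \<Longrightarrow> 0 \<le> b r \<and> b r \<le> B" and B: "0 \<le> B"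
  shows "(\<lambda>z. integral {s..t} (\<lambda>r. Ln (1 + of_real (b r) * z))) holomorphic_on {z. - 1 / (B + 1) < Re z}"
proof -
  let ?U = "{z. - 1 / (B + 1) < Re z}"
  have pos: "0 < Re (1 + of_real (b r) * z)" if "z \<in> ?U" "r \<in> {s..t}" for z r
    using Re_one_plus_mult_pos[of "b r" B z] b that by auto
  have nonpos: "1 + of_real (b r) * z \<notin> \<real>\<^sub>\<le>\<^sub>0" "1 + of_real (b r) * z \<noteq> 0" if "z \<in> ?U" "r \<in> {s..t}" for z r
    using pos[OF that] by (auto simp: complex_nonpos_Reals_iff complex_eq_iff)
  have "(\<lambda>z. integral (cbox s t) (\<lambda>r. Ln (1 + of_real (b r) * z))) holomorphic_on ?U"
  proof (rule leibniz_rule_holomorphic[where fx="\<lambda>z r. of_real (b r) / (1 + of_real (b r) * z)"])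
    show "((\<lambda>z. Ln (1 + of_real (b r) * z)) has_field_derivative of_real (b r) / (1 + of_real (b r) * z)) (at z within ?U)"
      if "z \<in> ?U" "r \<in> cbox s t" for z r
      using nonpos[of z r] that by (auto intro!: derivative_eq_intros simp: divide_inverse mult.commute)
    show "(\<lambda>r. Ln (1 + of_real (b r) * z)) integrable_on cbox s t" if "z \<in> ?U" for z
      using nonpos(1)[OF that] b by (intro integrable_continuous) (auto intro!: continuous_intros)
    have "continuous_on (?U \<times> cbox s t) (\<lambda>x. b (snd x))"
      by (rule continuous_on_compose2[OF b(1)]) (auto intro!: continuous_intros)
    then show "continuous_on (?U \<times> cbox s t) (\<lambda>(z, r). of_real (b r) / (1 + of_real (b r) * z))"
      using nonpos(2) by (auto simp: case_prod_unfold intro!: continuous_intros)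
    show "convex ?U" by (rule convex_halfspace_Re_gt)
  qed
  then show ?thesis by simp
qed

section \<open>Increments of the Gamma subordinator\<close>

context prob_space
begin

lemma inhomogeneous_Gamma_subordinator_iexp:
  assumes \<Gamma>: "inhomogeneous_Gamma_subordinator b \<Gamma>"
    and b: "continuous_on {0..} b" and st: "0 \<le> s" "s \<le> t"
  shows "(\<integral>\<omega>. exp (\<i> * of_real (\<xi> * (\<Gamma> t \<omega> - \<Gamma> s \<omega>))) \<partial>M) =
         exp (- integral {s..t} (\<lambda>r. Ln (1 - \<i> * of_real (b r * \<xi>))))"
proof -
  \<comment> \<open>\<open>b\<close> is controlled only on the nonnegative reals; clamping its
    argument makes it continuous, hence measurable, on the whole line.\<close>
  define b' where "b' r = b (max 0 r)" for r
  have b'cont: "continuous_on UNIV b'"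
    unfolding b'_def by (rule continuous_on_compose2[OF b]) (auto intro!: continuous_intros)
  note [measurable] = borel_measurable_continuous_onI[OF b'cont]
  have nonpos: "1 - \<i> * of_real x \<notin> \<real>\<^sub>\<le>\<^sub>0" for x :: real
    by (auto simp: complex_nonpos_Reals_iff)
  \<comment> \<open>Two times with opposite weights turn the joint characteristic function into that
    of the increment.\<close>
  let ?t = "\<lambda>j::nat. if j = 0 then t else s" and ?\<xi> = "\<lambda>j::nat. if j = 0 then \<xi> else - \<xi>"
  have "(\<integral>\<omega>. exp (\<i> * of_real (\<Sum>j<2. ?\<xi> j * \<Gamma> (?t j) \<omega>)) \<partial>M) =
      exp (- (LINT r:{0<..}|lborel. Ln (1 - \<i> * of_real (b r * (\<Sum>j<2. ?\<xi> j * indicator {0<..<?t j} r)))))"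
    using \<Gamma> st unfolding inhomogeneous_Gamma_subordinator_def
    by (elim conjE allE[of _ "2::nat"] allE[of _ ?\<xi>] allE[of _ ?t]) auto
  also have "(\<lambda>\<omega>. exp (\<i> * of_real (\<Sum>j<2. ?\<xi> j * \<Gamma> (?t j) \<omega>))) = (\<lambda>\<omega>. exp (\<i> * of_real (\<xi> * (\<Gamma> t \<omega> - \<Gamma> s \<omega>))))"
    by (simp add: numeral_2_eq_2 algebra_simps)
  also have "(LINT r:{0<..}|lborel. Ln (1 - \<i> * of_real (b r * (\<Sum>j<2. ?\<xi> j * indicator {0<..<?t j} r)))) =
      (LINT r:{0<..}|lborel. Ln (1 - \<i> * of_real (b' r * (\<xi> * indicator {0<..<t} r - \<xi> * indicator {0<..<s} r))))"
    unfolding set_lebesgue_integral_def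
    by (intro Bochner_Integration.integral_cong refl) (auto simp: indicator_def b'_def numeral_2_eq_2)
  also have "\<dots> = (LINT r:{s..t}|lborel. Ln (1 - \<i> * of_real (b' r * \<xi>)))"
    unfolding set_lebesgue_integral_def
  proof (rule integral_cong_AE)
    \<comment> \<open>On the positive reals the difference of indicators is 1 on
      \<open>{s..<t}\<close> and 0 elsewhere, where the integrand is \<open>Ln 1 = 0\<close>. Only
      the points 0 (if \<open>s = 0\<close>) and \<open>t\<close> distinguish this from
      \<open>{s..t}\<close>.\<close>
    show "AE r in lborel. indicator {0<..} r *\<^sub>R Ln (1 - \<i> * of_real (b' r * (\<xi> * indicator {0<..<t} r - \<xi> * indicator {0<..<s} r))) =
        indicator {s..t} r *\<^sub>R Ln (1 - \<i> * of_real (b' r * \<xi>))"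
      using AE_lborel_singleton[of 0] AE_lborel_singleton[of t]
      by eventually_elim (use st in \<open>auto simp: indicator_def\<close>)
  qed measurable
  also have "\<dots> = integral {s..t} (\<lambda>r. Ln (1 - \<i> * of_real (b' r * \<xi>)))"
  proof (rule set_borel_integral_eq_integral)
    show "set_integrable lborel {s..t} (\<lambda>r. Ln (1 - \<i> * of_real (b' r * \<xi>)))"
      by (intro borel_integrable_atLeastAtMost' continuous_intros nonpos continuous_on_subset[OF b'cont]) simp
  qed
  also have "\<dots> = integral {s..t} (\<lambda>r. Ln (1 - \<i> * of_real (b r * \<xi>)))"
    using st by (intro Henstock_Kurzweil_Integration.integral_cong) (auto simp: b'_def)
  finally show ?thesis .
qed

lemma inhomogeneous_Gamma_subordinator_laplace:
  assumes \<Gamma>: "inhomogeneous_Gamma_subordinator b \<Gamma>"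
    and b: "continuous_on {0..} b" "bounded (b ` {0..})" "\<And>t. t \<ge> 0 \<Longrightarrow> b t > 0"
    and st: "0 \<le> s" "s \<le> t" and z: "0 \<le> Re z"
  shows "(\<integral>\<omega>. exp (- of_real (\<Gamma> t \<omega> - \<Gamma> s \<omega>) * z) \<partial>M) =
         exp (- integral {s..t} (\<lambda>r. Ln (1 + of_real (b r) * z)))"
proof -
  have [measurable]: "random_variable borel (\<Gamma> t)" "random_variable borel (\<Gamma> s)"
    using \<Gamma> st by (auto simp: inhomogeneous_Gamma_subordinator_def additive_process_def process_def)
  have mono: "AE \<omega> in M. mono_on {0..} (\<lambda>t. \<Gamma> t \<omega>)"
    using \<Gamma> by (auto simp: inhomogeneous_Gamma_subordinator_def)
  \<comment> \<open>Paths are monotone only almost surely, while the lemmas on Laplace transforms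
    ask for a variable that is nonnegative everywhere.\<close>
  define X where "X \<omega> = max 0 (\<Gamma> t \<omega> - \<Gamma> s \<omega>)" for \<omega>
  have [measurable]: "random_variable borel X"
    unfolding X_def by measurable
  have X0: "0 \<le> X \<omega>" for \<omega>
    by (simp add: X_def)
  have X: "AE \<omega> in M. X \<omega> = \<Gamma> t \<omega> - \<Gamma> s \<omega>"
    using mono by eventually_elim (use st in \<open>auto simp: X_def mono_on_def\<close>)
  obtain B where B: "\<And>r. 0 \<le> r \<Longrightarrow> b r \<le> B"
    using b(2) by (auto simp: bounded_iff dest!: abs_le_D1)
  have B0: "0 \<le> B"
    using B[of 0] b(3)[of 0] by simp
  let ?L = "\<lambda>z. integral {s..t} (\<lambda>r. Ln (1 + of_real (b r) * z))"
  have hol: "?L holomorphic_on {z. - 1 / (B + 1) < Re z}"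
    using b B B0 st by (intro integral_Ln_holomorphic) (auto intro: continuous_on_subset less_imp_le)
  have sub: "{z. 0 \<le> Re z} \<subseteq> {z. - 1 / (B + 1) < Re z}"
    using B0 by (auto intro: less_le_trans[of _ 0])
  have hol_exp: "(\<lambda>z. exp (- ?L z)) holomorphic_on {z. - 1 / (B + 1) < Re z}"
    by (intro holomorphic_intros hol)
  have "(\<integral>\<omega>. exp (- of_real (X \<omega>) * z) \<partial>M) = exp (- ?L z)"
  proof (rule eq_on_right_half_plane[where f="\<lambda>z. \<integral>\<omega>. exp (- of_real (X \<omega>) * z) \<partial>M" and g="\<lambda>z. exp (- ?L z)"])
    show "continuous_on {z. 0 \<le> Re z} (\<lambda>z. exp (- ?L z))"
      using holomorphic_on_imp_continuous_on[OF hol_exp] sub by (rule continuous_on_subset)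
    show "(\<lambda>z. exp (- ?L z)) holomorphic_on {z. 0 < Re z}"
      using hol_exp by (rule holomorphic_on_subset) (rule order_trans[OF _ sub], auto)
    fix z assume "Re z = 0"
    \<comment> \<open>With this sign exp (- X z) becomes exp (\<i> \<xi> X), the integrand of the
      characteristic function.\<close>
    define \<xi> where "\<xi> = - Im z"
    have z: "z = - \<i> * of_real \<xi>"
      using \<open>Re z = 0\<close> by (simp add: complex_eq_iff \<xi>_def)
    have "(\<integral>\<omega>. exp (- of_real (X \<omega>) * z) \<partial>M) = (\<integral>\<omega>. exp (\<i> * of_real (\<xi> * (\<Gamma> t \<omega> - \<Gamma> s \<omega>))) \<partial>M)"
      by (rule integral_cong_AE) (use X in \<open>auto simp: z mult_ac elim!: eventually_mono\<close>)
    then show "(\<integral>\<omega>. exp (- of_real (X \<omega>) * z) \<partial>M) = exp (- ?L z)"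
      using inhomogeneous_Gamma_subordinator_iexp[OF \<Gamma> b(1) st, of \<xi>] by (simp add: z mult_ac)
  qed (use X0 z laplace_holomorphic laplace_continuous in auto)
  moreover have "(\<integral>\<omega>. exp (- of_real (X \<omega>) * z) \<partial>M) = (\<integral>\<omega>. exp (- of_real (\<Gamma> t \<omega> - \<Gamma> s \<omega>) * z) \<partial>M)"
  proof (rule integral_cong_AE)
    show "AE \<omega> in M. exp (- of_real (X \<omega>) * z) = exp (- of_real (\<Gamma> t \<omega> - \<Gamma> s \<omega>) * z)"
      using X by eventually_elim (simp only:)
  qed measurable
  ultimately show ?thesis by simp
qed

end

section \<open>Increments of the subordinated process\<close>

context prob_space
begin

text \<open>The joint law is a product, so \<open>Y\<close> can be frozen while \<open>X\<close> is
  integrated. In the application both variables are whole paths.\<close>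

lemma indep_var_integral:
  fixes F :: "'b \<Rightarrow> 'b \<Rightarrow> 'd::{banach, second_countable_topology}"
  assumes indep: "indep_var N1 X N2 Y"
    and F: "case_prod F \<in> borel_measurable (N1 \<Otimes>\<^sub>M N2)"
    and bound: "\<And>x y. norm (F x y) \<le> B"
  shows "(\<integral>\<omega>. F (X \<omega>) (Y \<omega>) \<partial>M) = (\<integral>\<omega>'. (\<integral>\<omega>. F (X \<omega>) (Y \<omega>') \<partial>M) \<partial>M)"
proof -
  note rv [measurable] = indep_var_rv1[OF indep] indep_var_rv2[OF indep]
  note [measurable] = F
  interpret N1: prob_space "distr M N1 X" by (rule prob_space_distr) fact
  interpret N2: prob_space "distr M N2 Y" by (rule prob_space_distr) fact
  interpret P: pair_prob_space "distr M N1 X" "distr M N2 Y" ..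
  have int: "integrable (distr M N1 X \<Otimes>\<^sub>M distr M N2 Y) (case_prod F)"
    by (rule P.integrable_const_bound[where B=B]) (auto simp: bound)
  have "(\<integral>\<omega>. F (X \<omega>) (Y \<omega>) \<partial>M) = (\<integral>p. case_prod F p \<partial>distr M (N1 \<Otimes>\<^sub>M N2) (\<lambda>\<omega>. (X \<omega>, Y \<omega>)))"
    by (subst integral_distr) auto
  also have "\<dots> = (\<integral>p. case_prod F p \<partial>(distr M N1 X \<Otimes>\<^sub>M distr M N2 Y))"
    using indep by (simp add: indep_var_distribution_eq)
  also have "\<dots> = (\<integral>y. (\<integral>x. F x y \<partial>distr M N1 X) \<partial>distr M N2 Y)"
    by (rule P.integral_snd[OF int, symmetric])
  also have "\<dots> = (\<integral>\<omega>'. (\<integral>x. F x (Y \<omega>') \<partial>distr M N1 X) \<partial>M)"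
    by (rule integral_distr) auto
  also have "\<dots> = (\<integral>\<omega>'. (\<integral>\<omega>. F (X \<omega>) (Y \<omega>') \<partial>M) \<partial>M)"
  proof (intro Bochner_Integration.integral_cong refl)
    fix \<omega>' assume "\<omega>' \<in> space M"
    then have "Y \<omega>' \<in> space N2"
      using rv(2) by (rule measurable_space[rotated])
    then have "(\<lambda>x. F x (Y \<omega>')) \<in> borel_measurable N1"
      by measurable
    then show "(\<integral>x. F x (Y \<omega>') \<partial>distr M N1 X) = (\<integral>\<omega>. F (X \<omega>) (Y \<omega>') \<partial>M)"
      by (rule integral_distr[OF rv(1)])
  qed
  finally show ?thesis .
qed

text \<open>Stationarity shifts the increment to start at time 0, where \<open>S\<close> vanishes
  almost surely.\<close>

lemma stable_process_increment:
  assumes S: "stable_process \<alpha> \<theta> S" and pq: "0 \<le> p" "p \<le> q"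
  shows "(\<integral>\<omega>. exp (\<i> * of_real (\<xi> * (S q \<omega> - S p \<omega>))) \<partial>M) = exp (- of_real (q - p) * psi \<alpha> \<theta> \<xi>)"
proof -
  have L: "Levy_process S" and char: "\<And>t. 0 \<le> t \<Longrightarrow> char (distr M borel (S t)) \<xi> = exp (- of_real t * psi \<alpha> \<theta> \<xi>)"
    using S by (auto simp: stable_process_def)
  have rv: "random_variable borel (S t)" if "0 \<le> t" for t
    using L that by (auto simp: Levy_process_def additive_process_def process_def)
  have S0: "AE \<omega> in M. S 0 \<omega> = 0"
    using L by (auto simp: Levy_process_def additive_process_def)
  have [measurable]: "random_variable borel (S p)" "random_variable borel (S q)"
    "random_variable borel (S 0)" "random_variable borel (S (q - p))"
    using pq by (auto intro: rv)
  have distr: "distr M borel (\<lambda>\<omega>. S q \<omega> - S p \<omega>) = distr M borel (\<lambda>\<omega>. S (q - p) \<omega> - S 0 \<omega>)"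
  proof -
    have "distr M borel (\<lambda>\<omega>. S (p + (q - p)) \<omega> - S p \<omega>) = distr M borel (\<lambda>\<omega>. S (q - p) \<omega> - S 0 \<omega>)"
      using L pq unfolding Levy_process_def stationary_increments_def by (meson diff_ge_0_iff_ge)
    then show ?thesis by simp
  qed
  have "(\<integral>\<omega>. exp (\<i> * of_real (\<xi> * (S q \<omega> - S p \<omega>))) \<partial>M) =
      (\<integral>x. exp (\<i> * of_real (\<xi> * x)) \<partial>distr M borel (\<lambda>\<omega>. S q \<omega> - S p \<omega>))"
    by (subst integral_distr) auto
  also have "\<dots> = (\<integral>\<omega>. exp (\<i> * of_real (\<xi> * (S (q - p) \<omega> - S 0 \<omega>))) \<partial>M)"
    unfolding distr by (subst integral_distr) auto
  also have "\<dots> = (\<integral>\<omega>. exp (\<i> * of_real (\<xi> * S (q - p) \<omega>)) \<partial>M)"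
    by (rule integral_cong_AE) (use S0 in \<open>auto elim!: eventually_mono\<close>)
  also have "\<dots> = char (distr M borel (S (q - p))) \<xi>"
    unfolding char_def by (subst integral_distr) auto
  also have "\<dots> = exp (- of_real (q - p) * psi \<alpha> \<theta> \<xi>)"
    using pq by (intro char) simp
  finally show ?thesis .
qed

end

text \<open>Rounding strictly upwards, so that right-continuity of paths applies along the grids.\<close>

definition round_up :: "nat \<Rightarrow> real \<Rightarrow> real" where
  "round_up n v = (real (nat \<lfloor>real (Suc n) * v\<rfloor>) + 1) / real (Suc n)"

lemma round_up_nonneg: "0 \<le> round_up n v"
  by (simp add: round_up_def)

lemma round_up_mono: "v \<le> w \<Longrightarrow> round_up n v \<le> round_up n w"
  unfolding round_up_def
  by (intro divide_right_mono add_right_mono of_nat_mono nat_mono floor_mono mult_left_mono) auto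

lemma round_up_bounds:
  assumes "0 \<le> v"
  shows "v < round_up n v" "round_up n v \<le> v + 1 / real (Suc n)"
proof -
  have "real (nat \<lfloor>real (Suc n) * v\<rfloor>) = of_int \<lfloor>real (Suc n) * v\<rfloor>"
    using assms by simp
  then have eq: "round_up n v = (of_int \<lfloor>real (Suc n) * v\<rfloor> + 1) / real (Suc n)"
    by (simp only: round_up_def)
  have "real (Suc n) * v < of_int \<lfloor>real (Suc n) * v\<rfloor> + 1" "of_int \<lfloor>real (Suc n) * v\<rfloor> \<le> real (Suc n) * v"
    by linarith+
  then show "v < round_up n v" "round_up n v \<le> v + 1 / real (Suc n)"
    unfolding eq by (simp_all add: field_simps del: of_nat_Suc)
qed

lemma filterlim_round_up:
  assumes "0 \<le> v"
  shows "filterlim (\<lambda>n. round_up n v) (at_right v) sequentially"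
proof (rule tendsto_imp_filterlim_at_right)
  have "(\<lambda>n. 1 / real (Suc n)) \<longlonglongrightarrow> 0"
    by (rule LIMSEQ_Suc) (rule lim_1_over_n)
  then have "(\<lambda>n. v + 1 / real (Suc n)) \<longlonglongrightarrow> v + 0"
    by (intro tendsto_intros)
  then show "(\<lambda>n. round_up n v) \<longlonglongrightarrow> v"
    using round_up_bounds[OF assms]
    by (intro tendsto_sandwich[OF _ _ tendsto_const, of v "\<lambda>n. round_up n v" _ "\<lambda>n. v + 1 / real (Suc n)"])
      (auto simp: less_imp_le)
qed (use round_up_bounds[OF assms] in auto)

text \<open>Evaluating \<open>x\<close> at \<open>y t\<close> depends on uncountably many
  coordinates of \<open>x\<close> and is not measurable for the product sigma-algebra. The rounded
  time has countably many values, so here countably many coordinate maps are glued along measurable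
  sets.\<close>

lemma measurable_process_at_round_up:
  "(\<lambda>p. fst p (round_up n (snd p t))) \<in> borel_measurable
     ((\<Pi>\<^sub>M t\<in>{0..}. borel :: real measure) \<Otimes>\<^sub>M (\<Pi>\<^sub>M t\<in>{0..}. borel))"
  if "0 \<le> t" for t :: real
proof -
  let ?P = "\<Pi>\<^sub>M t\<in>{0::real..}. borel :: real measure"
  have [measurable]: "(\<lambda>y. y t) \<in> borel_measurable ?P"
    using that by (intro measurable_component_singleton) simp
  have [measurable]: "(\<lambda>x. x ((real k + 1) / real (Suc n))) \<in> borel_measurable ?P" for k
    by (intro measurable_component_singleton) simp
  have "(\<lambda>p. fst p ((real (nat \<lfloor>real (Suc n) * snd p t\<rfloor>) + 1) / real (Suc n))) \<in> borel_measurable (?P \<Otimes>\<^sub>M ?P)"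
  proof (rule measurable_compose_countable[where f="\<lambda>k p. fst p ((real k + 1) / real (Suc n))"])
    show "(\<lambda>p. fst p ((real k + 1) / real (Suc n))) \<in> borel_measurable (?P \<Otimes>\<^sub>M ?P)" for k
      by measurable
    show "(\<lambda>p. nat \<lfloor>real (Suc n) * snd p t\<rfloor>) \<in> (?P \<Otimes>\<^sub>M ?P) \<rightarrow>\<^sub>M count_space UNIV"
      by measurable
  qed
  then show ?thesis
    by (simp only: round_up_def)
qed

text \<open>For rounded times the identity is the freezing of the path of \<open>\<Gamma>\<close>
  followed by the law of the increments of \<open>S\<close>. Both sides converge by dominated
  convergence as the grid is refined: the left by right-continuity of the paths of \<open>S\<close>,
  the right because the rounded times converge.\<close>

lemma (in prob_space) subordinate_increment_iexp:
  assumes S: "stable_process \<alpha> \<theta> S" and \<Gamma>: "process \<Gamma>" "AE \<omega> in M. \<Gamma> 0 \<omega> = 0"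
    "AE \<omega> in M. mono_on {0..} (\<lambda>t. \<Gamma> t \<omega>)"
    and indep: "independent_processes S \<Gamma>" and G: "process (subordinate S \<Gamma>)"
    and st: "0 \<le> s" "s \<le> t" and psi: "0 \<le> Re (psi \<alpha> \<theta> \<xi>)"
  shows "(\<integral>\<omega>. exp (\<i> * of_real (\<xi> * (subordinate S \<Gamma> t \<omega> - subordinate S \<Gamma> s \<omega>))) \<partial>M) =
         (\<integral>\<omega>. exp (- of_real (\<Gamma> t \<omega> - \<Gamma> s \<omega>) * psi \<alpha> \<theta> \<xi>) \<partial>M)"
proof -
  let ?P = "\<Pi>\<^sub>M t\<in>{0::real..}. borel :: real measure"
  let ?X = "\<lambda>\<omega>. \<lambda>t\<in>{0..}. S t \<omega>" and ?Y = "\<lambda>\<omega>. \<lambda>t\<in>{0..}. \<Gamma> t \<omega>"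
  have t: "0 \<le> t" using st by simp
  have [measurable]: "random_variable borel (subordinate S \<Gamma> t)" "random_variable borel (subordinate S \<Gamma> s)"
    "random_variable borel (\<Gamma> t)" "random_variable borel (\<Gamma> s)"
    using G \<Gamma>(1) st by (auto simp: process_def)
  have indep': "indep_var ?P ?X ?P ?Y"
    using indep by (simp add: independent_processes_def)
  note [measurable] = indep_var_rv1[OF indep'] indep_var_rv2[OF indep']
  have cadlag: "AE \<omega> in M. cadlag (\<lambda>t. S t \<omega>)"
    using S by (auto simp: stable_process_def Levy_process_def)
  define F where "F n x y = exp (\<i> * of_real (\<xi> * (x (round_up n (y t)) - x (round_up n (y s)))))"
    for n and x y :: "real \<Rightarrow> real"
  note [measurable] = measurable_process_at_round_up[OF t] measurable_process_at_round_up[OF st(1)]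
  have F [measurable]: "case_prod (F n) \<in> borel_measurable (?P \<Otimes>\<^sub>M ?P)" for n
    unfolding F_def case_prod_unfold by measurable
  have [measurable]: "(\<lambda>\<omega>. F n (?X \<omega>) (?Y \<omega>)) \<in> borel_measurable M" for n
    using measurable_compose[OF measurable_Pair[OF indep_var_rv1[OF indep'] indep_var_rv2[OF indep']] F]
    by simp
  have [measurable]: "round_up n \<in> borel_measurable borel" for n
    unfolding round_up_def by measurable
  have ordered: "AE \<omega> in M. 0 \<le> \<Gamma> s \<omega> \<and> \<Gamma> s \<omega> \<le> \<Gamma> t \<omega>"
    using \<Gamma>(2,3)
  proof eventually_elim
    fix \<omega> assume "\<Gamma> 0 \<omega> = 0" "mono_on {0..} (\<lambda>t. \<Gamma> t \<omega>)"
    then show "0 \<le> \<Gamma> s \<omega> \<and> \<Gamma> s \<omega> \<le> \<Gamma> t \<omega>"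
      using st mono_onD[of "{0..}" "\<lambda>t. \<Gamma> t \<omega>" 0 s] mono_onD[of "{0..}" "\<lambda>t. \<Gamma> t \<omega>" s t] by auto
  qed
  have eq: "(\<integral>\<omega>. F n (?X \<omega>) (?Y \<omega>) \<partial>M) =
      (\<integral>\<omega>. exp (- of_real (round_up n (\<Gamma> t \<omega>) - round_up n (\<Gamma> s \<omega>)) * psi \<alpha> \<theta> \<xi>) \<partial>M)" for n
  proof -
    \<comment> \<open>Rounded times are nonnegative, so restricting the paths to
      \<open>{0..}\<close> changes nothing.\<close>
    have inner: "(\<integral>\<omega>. F n (?X \<omega>) (?Y \<omega>') \<partial>M) =
        (\<integral>\<omega>. exp (\<i> * of_real (\<xi> * (S (round_up n (\<Gamma> t \<omega>')) \<omega> - S (round_up n (\<Gamma> s \<omega>')) \<omega>))) \<partial>M)" for \<omega>'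
      using st by (simp add: F_def round_up_nonneg)
    have "(\<integral>\<omega>. F n (?X \<omega>) (?Y \<omega>) \<partial>M) = (\<integral>\<omega>'. (\<integral>\<omega>. F n (?X \<omega>) (?Y \<omega>') \<partial>M) \<partial>M)"
      by (rule indep_var_integral[OF indep' F, where B=1]) (simp add: F_def)
    also have "\<dots> = (\<integral>\<omega>. exp (- of_real (round_up n (\<Gamma> t \<omega>) - round_up n (\<Gamma> s \<omega>)) * psi \<alpha> \<theta> \<xi>) \<partial>M)"
    proof (rule integral_cong_AE)
      show "AE \<omega>' in M. (\<integral>\<omega>. F n (?X \<omega>) (?Y \<omega>') \<partial>M) =
          exp (- of_real (round_up n (\<Gamma> t \<omega>') - round_up n (\<Gamma> s \<omega>')) * psi \<alpha> \<theta> \<xi>)"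
        using ordered
        by eventually_elim
          (simp only: inner stable_process_increment[OF S round_up_nonneg round_up_mono])
      have "(\<lambda>(y, \<omega>). F n (?X \<omega>) y) \<in> borel_measurable (?P \<Otimes>\<^sub>M M)"
        using measurable_compose[OF measurable_Pair[OF measurable_compose[OF measurable_snd indep_var_rv1[OF indep']] measurable_fst] F]
        by (simp add: case_prod_unfold)
      from measurable_compose[OF indep_var_rv2[OF indep'] borel_measurable_lebesgue_integral[OF this]]
      show "(\<lambda>\<omega>'. \<integral>\<omega>. F n (?X \<omega>) (?Y \<omega>') \<partial>M) \<in> borel_measurable M"
        by simp
    qed measurable
    finally show ?thesis .
  qed
  have lim1: "(\<lambda>n. \<integral>\<omega>. F n (?X \<omega>) (?Y \<omega>) \<partial>M) \<longlonglongrightarrow>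
      (\<integral>\<omega>. exp (\<i> * of_real (\<xi> * (subordinate S \<Gamma> t \<omega> - subordinate S \<Gamma> s \<omega>))) \<partial>M)"
  proof (rule integral_dominated_convergence[where w="\<lambda>_. 1"])
    show "AE \<omega> in M. (\<lambda>n. F n (?X \<omega>) (?Y \<omega>)) \<longlonglongrightarrow>
        exp (\<i> * of_real (\<xi> * (subordinate S \<Gamma> t \<omega> - subordinate S \<Gamma> s \<omega>)))"
      using ordered cadlag
    proof eventually_elim
      fix \<omega> assume \<Gamma>\<omega>: "0 \<le> \<Gamma> s \<omega> \<and> \<Gamma> s \<omega> \<le> \<Gamma> t \<omega>" and cad: "cadlag (\<lambda>t. S t \<omega>)"
      have "(\<lambda>n. S (round_up n v) \<omega>) \<longlonglongrightarrow> S v \<omega>" if "0 \<le> v" for v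
        using cad that filterlim_compose[OF _ filterlim_round_up[OF that]] by (auto simp: cadlag_def)
      then have "(\<lambda>n. exp (\<i> * of_real (\<xi> * (S (round_up n (\<Gamma> t \<omega>)) \<omega> - S (round_up n (\<Gamma> s \<omega>)) \<omega>)))) \<longlonglongrightarrow>
          exp (\<i> * of_real (\<xi> * (S (\<Gamma> t \<omega>) \<omega> - S (\<Gamma> s \<omega>) \<omega>)))"
        using \<Gamma>\<omega> by (intro tendsto_intros) auto
      then show "(\<lambda>n. F n (?X \<omega>) (?Y \<omega>)) \<longlonglongrightarrow>
          exp (\<i> * of_real (\<xi> * (subordinate S \<Gamma> t \<omega> - subordinate S \<Gamma> s \<omega>)))"
        using st by (simp add: F_def round_up_nonneg subordinate_def)
    qed
    show "(\<lambda>\<omega>. F n (?X \<omega>) (?Y \<omega>)) \<in> borel_measurable M" for n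
      by measurable
  qed (auto simp: F_def)
  have lim2: "(\<lambda>n. \<integral>\<omega>. exp (- of_real (round_up n (\<Gamma> t \<omega>) - round_up n (\<Gamma> s \<omega>)) * psi \<alpha> \<theta> \<xi>) \<partial>M) \<longlonglongrightarrow>
      (\<integral>\<omega>. exp (- of_real (\<Gamma> t \<omega> - \<Gamma> s \<omega>) * psi \<alpha> \<theta> \<xi>) \<partial>M)"
  proof (rule integral_dominated_convergence[where w="\<lambda>_. 1"])
    show "AE \<omega> in M. (\<lambda>n. exp (- of_real (round_up n (\<Gamma> t \<omega>) - round_up n (\<Gamma> s \<omega>)) * psi \<alpha> \<theta> \<xi>)) \<longlonglongrightarrow>
        exp (- of_real (\<Gamma> t \<omega> - \<Gamma> s \<omega>) * psi \<alpha> \<theta> \<xi>)"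
      using ordered
    proof eventually_elim
      fix \<omega> assume \<Gamma>\<omega>: "0 \<le> \<Gamma> s \<omega> \<and> \<Gamma> s \<omega> \<le> \<Gamma> t \<omega>"
      have "(\<lambda>n. round_up n v) \<longlonglongrightarrow> v" if "0 \<le> v" for v
        using filterlim_round_up[OF that] by (simp add: filterlim_at)
      then show "(\<lambda>n. exp (- of_real (round_up n (\<Gamma> t \<omega>) - round_up n (\<Gamma> s \<omega>)) * psi \<alpha> \<theta> \<xi>)) \<longlonglongrightarrow>
          exp (- of_real (\<Gamma> t \<omega> - \<Gamma> s \<omega>) * psi \<alpha> \<theta> \<xi>)"
        using \<Gamma>\<omega> by (intro tendsto_intros) auto
    qed
    \<comment> \<open>Rounding is monotone, so the rounded increment stays nonnegative; with Re
      \<open>psi\<close> \<ge> 0 the exponential has modulus at most 1.\<close>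
    show "AE \<omega> in M. norm (exp (- of_real (round_up n (\<Gamma> t \<omega>) - round_up n (\<Gamma> s \<omega>)) * psi \<alpha> \<theta> \<xi>)) \<le> 1" for n
      using ordered
    proof eventually_elim
      fix \<omega> assume "0 \<le> \<Gamma> s \<omega> \<and> \<Gamma> s \<omega> \<le> \<Gamma> t \<omega>"
      then have "0 \<le> (round_up n (\<Gamma> t \<omega>) - round_up n (\<Gamma> s \<omega>)) * Re (psi \<alpha> \<theta> \<xi>)"
        using psi by (simp add: round_up_mono)
      then show "norm (exp (- of_real (round_up n (\<Gamma> t \<omega>) - round_up n (\<Gamma> s \<omega>)) * psi \<alpha> \<theta> \<xi>)) \<le> 1"
        by (simp add: left_diff_distrib)
    qed
  qed auto
  show ?thesis
    by (rule LIMSEQ_unique[OF lim1]) (use lim2 in \<open>simp only: eq\<close>)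
qed

section \<open>The evolution equation\<close>

text \<open>Mean value inequality from \<open>Ln 1 = 0\<close>: the derivative 1/z has modulus at
  most 1 on the convex set Re z \<ge> 1.\<close>

lemma norm_Ln_one_plus_le:
  assumes "0 \<le> Re w"
  shows "norm (Ln (1 + w)) \<le> norm w"
proof -
  have "norm (Ln (1 + w) - Ln 1) \<le> 1 * norm (1 + w - 1)"
  proof (rule field_differentiable_bound[where S="{z. 1 \<le> Re z}" and f'="\<lambda>z. inverse z"])
    show "convex {z. 1 \<le> Re z}" by (rule convex_halfspace_Re_ge)
    fix z assume "z \<in> {z. 1 \<le> Re z}"
    then have z: "1 \<le> Re z" by simp
    then show "(Ln has_field_derivative inverse z) (at z within {z. 1 \<le> Re z})"
      by (intro has_field_derivative_at_within[OF has_field_derivative_Ln]) (auto simp: complex_nonpos_Reals_iff)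
    have "1 \<le> norm z"
      using z complex_Re_le_cmod[of z] by linarith
    then show "norm (inverse z) \<le> 1"
      by (simp add: norm_inverse inverse_le_1_iff)
  qed (use assms in auto)
  then show ?thesis by simp
qed

lemma norm_psi: "norm (psi \<alpha> \<theta> \<xi>) = \<bar>\<xi>\<bar> powr \<alpha>"
  unfolding psi_def norm_mult norm_exp_i_times by simp

lemma Re_psi_nonneg:
  assumes "\<bar>\<theta>\<bar> \<le> 1"
  shows "0 \<le> Re (psi \<alpha> \<theta> \<xi>)"
proof -
  have "\<bar>sgn \<xi> * pi * \<theta> / 2\<bar> \<le> pi / 2"
    using assms by (auto simp: abs_mult sgn_if)
  then have "0 \<le> cos (sgn \<xi> * pi * \<theta> / 2)"
    by (intro cos_ge_zero) (auto simp: abs_le_iff)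
  then show ?thesis
    unfolding psi_def by (simp add: Re_exp)
qed

lemma measurable_psi [measurable]: "psi \<alpha> \<theta> \<in> borel_measurable borel"
proof -
  have [measurable]: "(sgn :: real \<Rightarrow> real) \<in> borel_measurable borel"
    unfolding sgn_if by measurable
  show ?thesis
    unfolding psi_def by measurable
qed

lemma norm_psi_le:
  assumes "0 < \<alpha>" "\<alpha> \<le> 2"
  shows "norm (psi \<alpha> \<theta> \<xi>) \<le> 1 + \<bar>\<xi>\<bar> ^ 2"
proof (cases "\<bar>\<xi>\<bar> \<le> 1")
  case True
  then have "\<bar>\<xi>\<bar> powr \<alpha> \<le> 1"
    using assms by (intro powr_le1) auto
  then show ?thesis
    unfolding norm_psi using zero_le_power2[of "\<bar>\<xi>\<bar>"] by linarith
next
  case False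
  then have "\<bar>\<xi>\<bar> powr \<alpha> \<le> \<bar>\<xi>\<bar> powr 2"
    using assms by (intro powr_mono) auto
  also have "\<dots> = \<bar>\<xi>\<bar> ^ 2"
    using False by (subst powr_numeral) auto
  finally show ?thesis
    unfolding norm_psi by simp
qed

text \<open>A shift by \<open>Y\<close> multiplies the transform by a phase; by Fubini the
  expectation replaces that phase by the characteristic function of \<open>Y\<close>.\<close>

lemma (in prob_space) expectation_inverse_fourier:
  assumes [measurable]: "random_variable borel Y" and F: "integrable lborel F"
  shows "(\<integral>\<omega>. inverse_fourier F (x + Y \<omega>) \<partial>M) =
         inverse_fourier (\<lambda>\<xi>. (\<integral>\<omega>. exp (\<i> * of_real (\<xi> * Y \<omega>)) \<partial>M) * F \<xi>) x"
proof -
  note [measurable] = borel_measurable_integrable[OF F]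
  interpret pair_sigma_finite M lborel ..
  let ?k = "\<lambda>\<omega> \<xi>. exp (\<i> * of_real (\<xi> * x)) * (exp (\<i> * of_real (\<xi> * Y \<omega>)) * F \<xi>)"
  have int: "integrable (M \<Otimes>\<^sub>M lborel) (\<lambda>(\<omega>, \<xi>). ?k \<omega> \<xi>)"
  proof (rule Fubini_integrable)
    show "integrable M (\<lambda>\<omega>. \<integral>\<xi>. norm (case (\<omega>, \<xi>) of (\<omega>, \<xi>) \<Rightarrow> ?k \<omega> \<xi>) \<partial>lborel)"
      by (simp add: norm_mult)
    show "AE \<omega> in M. integrable lborel (\<lambda>\<xi>. case (\<omega>, \<xi>) of (\<omega>, \<xi>) \<Rightarrow> ?k \<omega> \<xi>)"
    proof (rule AE_I2)
      fix \<omega>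
      show "integrable lborel (\<lambda>\<xi>. case (\<omega>, \<xi>) of (\<omega>, \<xi>) \<Rightarrow> ?k \<omega> \<xi>)"
        unfolding prod.case by (rule integrable_exp_ii_mult[OF integrable_exp_ii_mult[OF F]])
    qed
  qed measurable
  have "(\<integral>\<omega>. inverse_fourier F (x + Y \<omega>) \<partial>M) =
      of_real (1 / sqrt (2 * pi)) * (\<integral>\<omega>. (\<integral>\<xi>. ?k \<omega> \<xi> \<partial>lborel) \<partial>M)"
    unfolding inverse_fourier_def integral_mult_right_zero distrib_left of_real_add exp_add mult.assoc ..
  also have "(\<integral>\<omega>. (\<integral>\<xi>. ?k \<omega> \<xi> \<partial>lborel) \<partial>M) = (\<integral>\<xi>. (\<integral>\<omega>. ?k \<omega> \<xi> \<partial>M) \<partial>lborel)"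
    by (rule Fubini_integral[OF int, symmetric])
  also have "of_real (1 / sqrt (2 * pi)) * \<dots> =
      inverse_fourier (\<lambda>\<xi>. (\<integral>\<omega>. exp (\<i> * of_real (\<xi> * Y \<omega>)) \<partial>M) * F \<xi>) x"
    unfolding inverse_fourier_def integral_mult_right_zero integral_mult_left_zero ..
  finally show ?thesis .
qed

theorem theorem17:
  fixes M :: "'a measure"
    and S \<Gamma> G :: "real \<Rightarrow> 'a \<Rightarrow> real"
    and b :: "real \<Rightarrow> real"
    and \<alpha> \<theta> s :: real
    and f :: "real \<Rightarrow> complex"
    and u :: "real \<Rightarrow> real \<Rightarrow> complex"
  assumes "prob_space M"
    and "0 < \<alpha>" "\<alpha> \<le> 2" "\<alpha> \<noteq> 1" "\<bar>\<theta>\<bar> \<le> min \<alpha> (2 - \<alpha>)"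
    and "continuous_on {0..} b" "bounded (b ` {0..})" "\<And>t. t \<ge> 0 \<Longrightarrow> b t > 0"
    and "prob_space.stable_process M \<alpha> \<theta> S"
    and "prob_space.inhomogeneous_Gamma_subordinator M b \<Gamma>"
    and "prob_space.independent_processes M S \<Gamma>"
    and "G = subordinate S \<Gamma>" "prob_space.process M G"
    and "Schwartz f" "s \<ge> 0"
    and "\<And>x t. u x t = prob_space.transition M G s t f x"
  shows "(\<forall>x. \<forall>t\<ge>s. ((\<lambda>\<tau>. u x \<tau>) has_vector_derivative
              P_operator \<alpha> \<theta> (b t) (\<lambda>y. u y t) x) (at t within {s..})) \<and>
         (\<forall>x. u x s = f x)"
proof -
  interpret prob_space M by fact
  note b = assms(6-8) and S = assms(9) and \<Gamma> = assms(10) and G = assms(12,13) and s = assms(15)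
  \<comment> \<open>The smaller of \<alpha> and 2 - \<alpha> never exceeds their mean, which is
    1.\<close>
  have \<theta>: "\<bar>\<theta>\<bar> \<le> 1"
    using assms(5) by linarith
  note psi0 = Re_psi_nonneg[OF \<theta>]
  have \<Gamma>': "process \<Gamma>" "AE \<omega> in M. \<Gamma> 0 \<omega> = 0" "AE \<omega> in M. mono_on {0..} (\<lambda>t. \<Gamma> t \<omega>)"
    using \<Gamma> by (auto simp: inhomogeneous_Gamma_subordinator_def additive_process_def)
  have rvG: "random_variable borel (G t)" if "0 \<le> t" for t
    using G that by (auto simp: process_def)
  define F where "F = (\<lambda>\<xi>. inverse_fourier f (- \<xi>))"
  have F: "rapidly_decaying F" and f_eq: "f = inverse_fourier F"
    unfolding F_def using assms(14) by (simp_all add: rapidly_decaying_fourier_Schwartz fourier_inversion_Schwartz)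
  have [measurable]: "F \<in> borel_measurable borel"
    using F by (simp add: rapidly_decaying_def)
  define \<phi> where "\<phi> t \<xi> = (\<integral>\<omega>. exp (\<i> * of_real (\<xi> * (G t \<omega> - G s \<omega>))) \<partial>M)" for t \<xi>
  have \<phi>_measurable [measurable]: "\<phi> t \<in> borel_measurable borel" if "s \<le> t" for t
  proof -
    have [measurable]: "random_variable borel (G t)" "random_variable borel (G s)"
      using rvG s that by auto
    show ?thesis unfolding \<phi>_def by measurable
  qed
  have \<phi>_le: "norm (\<phi> t \<xi>) \<le> 1" for t \<xi>
  proof -
    have "norm (\<phi> t \<xi>) \<le> (\<integral>\<omega>. norm (exp (\<i> * of_real (\<xi> * (G t \<omega> - G s \<omega>)))) \<partial>M)"
      unfolding \<phi>_def by (rule integral_norm_bound)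
    then show ?thesis
      by (simp only: norm_exp_i_times) (simp add: prob_space)
  qed
  have \<phi>_eq: "\<phi> t \<xi> = exp (- integral {s..t} (\<lambda>r. Ln (1 + of_real (b r) * psi \<alpha> \<theta> \<xi>)))" if "s \<le> t" for t \<xi>
    unfolding \<phi>_def G(1)
    using subordinate_increment_iexp[OF S \<Gamma>' assms(11) _ s that psi0]
      inhomogeneous_Gamma_subordinator_laplace[OF \<Gamma> b s that psi0] G
    by simp
  have u_eq: "u x t = inverse_fourier (\<lambda>\<xi>. \<phi> t \<xi> * F \<xi>) x" if "s \<le> t" for x t
  proof -
    have "random_variable borel (\<lambda>\<omega>. G t \<omega> - G s \<omega>)"
      using rvG s that by (intro borel_measurable_diff) auto
    from expectation_inverse_fourier[OF this integrable_rapidly_decaying[OF F], of x]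
    show ?thesis
      by (simp add: assms(16) transition_def f_eq \<phi>_def)
  qed
  \<comment> \<open>Degree 0 suffices here: the multiplier is bounded by 1, hence by
    \<open>1 * (1 + 1)\<close>.\<close>
  have \<phi>F: "rapidly_decaying (\<lambda>\<xi>. \<phi> t \<xi> * F \<xi>)" if "s \<le> t" for t
    by (rule rapidly_decaying_mult[OF F \<phi>_measurable[OF that], of 1 0]) (use order_trans[OF \<phi>_le[of t]] in simp)
  obtain B where B: "\<And>r. 0 \<le> r \<Longrightarrow> b r \<le> B"
    using b(2) by (auto simp: bounded_iff dest!: abs_le_D1)
  have B0: "0 \<le> B"
    using B[of 0] b(3)[of 0] by simp
  define L where "L t \<xi> = Ln (1 + of_real (b t) * psi \<alpha> \<theta> \<xi>)" for t \<xi>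
  have [measurable]: "L t \<in> borel_measurable borel" for t
    unfolding L_def by measurable
  have L_le: "norm (L t \<xi>) \<le> B * (1 + \<bar>\<xi>\<bar> ^ 2)" if "s \<le> t" for t \<xi>
  proof -
    have t: "0 \<le> t" using s that by simp
    have "norm (L t \<xi>) \<le> norm (of_real (b t) * psi \<alpha> \<theta> \<xi>)"
      unfolding L_def using b(3)[OF t] psi0[of \<alpha> \<xi>] by (intro norm_Ln_one_plus_le) simp
    also have "\<dots> = b t * norm (psi \<alpha> \<theta> \<xi>)"
      using b(3)[OF t] by (simp add: norm_mult)
    also have "\<dots> \<le> B * (1 + \<bar>\<xi>\<bar> ^ 2)"
      by (intro mult_mono B t norm_psi_le assms(2,3) B0) auto
    finally show ?thesis .
  qed
  have \<phi>_deriv: "((\<lambda>\<tau>. \<phi> \<tau> \<xi>) has_vector_derivative - L t \<xi> * \<phi> t \<xi>) (at t within {s..})" if t: "s \<le> t" for t \<xi>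
  proof -
    have nonpos: "1 + of_real (b r) * psi \<alpha> \<theta> \<xi> \<notin> \<real>\<^sub>\<le>\<^sub>0" if "0 \<le> r" for r
    proof -
      have "0 \<le> b r * Re (psi \<alpha> \<theta> \<xi>)"
        using b(3)[OF that] psi0 by simp
      then show ?thesis
        by (auto simp: complex_nonpos_Reals_iff)
    qed
    \<comment> \<open>The interval extends past \<open>t\<close>, so that differentiating the
      integral at its upper limit covers both sides of \<open>t\<close>; near \<open>t\<close> it
      coincides with \<open>{s..}\<close>. At \<open>t = s\<close> only the right derivative
      remains.\<close>
    have "continuous_on {s..t + 1} (\<lambda>r. L r \<xi>)"
      unfolding L_def using s
      by (intro continuous_intros nonpos continuous_on_subset[OF b(1)]) auto
    then have "((\<lambda>\<tau>. integral {s..\<tau>} (\<lambda>r. L r \<xi>)) has_vector_derivative L t \<xi>) (at t within {s..t + 1})"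
      using t by (intro integral_has_vector_derivative) auto
    then have "((\<lambda>\<tau>. integral {s..\<tau>} (\<lambda>r. L r \<xi>)) has_vector_derivative L t \<xi>) (at t within {s..})"
      by (subst at_within_nhd[of t "{..<t + 1}" "{s..}" "{s..t + 1}"]) auto
    from field_vector_diff_chain_within[OF has_vector_derivative_minus[OF this]
        has_field_derivative_at_within[OF DERIV_exp]]
    have "((\<lambda>\<tau>. exp (- integral {s..\<tau>} (\<lambda>r. L r \<xi>))) has_vector_derivative - L t \<xi> * \<phi> t \<xi>) (at t within {s..})"
      using t by (simp add: comp_def \<phi>_eq L_def mult.commute)
    then show ?thesis
      by (rule has_vector_derivative_transform[rotated 2]) (use t in \<open>auto simp: \<phi>_eq L_def\<close>)
  qed
  have "((\<lambda>\<tau>. u x \<tau>) has_vector_derivative P_operator \<alpha> \<theta> (b t) (\<lambda>y. u y t) x) (at t within {s..})"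
    if t: "s \<le> t" for x t
  proof -
    let ?e = "\<lambda>\<xi>. exp (\<i> * of_real (\<xi> * x))"
    have "((\<lambda>\<tau>. \<integral>\<xi>. ?e \<xi> * (\<phi> \<tau> \<xi> * F \<xi>) \<partial>lborel) has_derivative
        (\<lambda>h. \<integral>\<xi>. h *\<^sub>R (?e \<xi> * (- L t \<xi> * (\<phi> t \<xi> * F \<xi>))) \<partial>lborel)) (at t within {s..})"
    \<comment> \<open>The majorant is uniform in time: \<open>B\<close> bounds \<open>b\<close>
      everywhere, |\<phi>| \<le> 1, and the logarithm grows at most quadratically, which the rapid
      decay of \<open>F\<close> absorbs.\<close>
    proof (rule has_derivative_lebesgue_integral[where w="\<lambda>\<xi>. norm (of_real (B * (1 + \<bar>\<xi>\<bar> ^ 2)) * F \<xi>)"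
          and f'="\<lambda>\<tau> \<xi> h. h *\<^sub>R (?e \<xi> * (- L \<tau> \<xi> * (\<phi> \<tau> \<xi> * F \<xi>)))"])
      show "integrable lborel (\<lambda>\<xi>. ?e \<xi> * (\<phi> \<tau> \<xi> * F \<xi>))" if "\<tau> \<in> {s..}" for \<tau>
        using that by (intro integrable_exp_ii_mult integrable_rapidly_decaying \<phi>F) simp
      show "integrable lborel (\<lambda>\<xi>. norm (of_real (B * (1 + \<bar>\<xi>\<bar> ^ 2)) * F \<xi>))"
      proof (intro integrable_norm integrable_rapidly_decaying rapidly_decaying_mult[OF F, of _ B 2])
        show "norm (complex_of_real (B * (1 + \<bar>\<xi>\<bar> ^ 2))) \<le> B * (1 + \<bar>\<xi>\<bar> ^ 2)" for \<xi> :: real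
          unfolding norm_of_real using B0 by simp
      qed measurable
      fix \<tau> \<xi> assume \<tau>: "\<tau> \<in> {s..}"
      have "((\<lambda>\<tau>. ?e \<xi> * (\<phi> \<tau> \<xi> * F \<xi>)) has_vector_derivative ?e \<xi> * (- L \<tau> \<xi> * \<phi> \<tau> \<xi> * F \<xi>)) (at \<tau> within {s..})"
        by (intro has_vector_derivative_mult_right has_vector_derivative_mult_left \<phi>_deriv) (use \<tau> in simp)
      then show "((\<lambda>\<tau>. ?e \<xi> * (\<phi> \<tau> \<xi> * F \<xi>)) has_derivative (\<lambda>h. h *\<^sub>R (?e \<xi> * (- L \<tau> \<xi> * (\<phi> \<tau> \<xi> * F \<xi>))))) (at \<tau> within {s..})"
        by (simp only: has_vector_derivative_def mult.assoc)
      have "norm (?e \<xi> * (- L \<tau> \<xi> * (\<phi> \<tau> \<xi> * F \<xi>))) = norm (L \<tau> \<xi>) * (norm (\<phi> \<tau> \<xi>) * norm (F \<xi>))"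
        by (simp add: norm_mult)
      also have "\<dots> \<le> B * (1 + \<bar>\<xi>\<bar> ^ 2) * (1 * norm (F \<xi>))"
        using B0 \<tau> by (intro mult_mono L_le \<phi>_le) auto
      also have "\<dots> = norm (of_real (B * (1 + \<bar>\<xi>\<bar> ^ 2)) * F \<xi>)"
        unfolding norm_mult[of _ "F \<xi>"] norm_of_real using B0 by simp
      finally have le: "norm (?e \<xi> * (- L \<tau> \<xi> * (\<phi> \<tau> \<xi> * F \<xi>))) \<le> norm (of_real (B * (1 + \<bar>\<xi>\<bar> ^ 2)) * F \<xi>)" .
      show "onorm (\<lambda>h. h *\<^sub>R (?e \<xi> * (- L \<tau> \<xi> * (\<phi> \<tau> \<xi> * F \<xi>)))) \<le> norm (of_real (B * (1 + \<bar>\<xi>\<bar> ^ 2)) * F \<xi>)"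
        by (rule onorm_bound) (use mult_left_mono[OF le] in \<open>simp_all only: norm_scaleR norm_ge_zero abs_ge_zero real_norm_def mult.commute\<close>)
    next
      fix h
      show "(\<lambda>\<xi>. h *\<^sub>R (?e \<xi> * (- L t \<xi> * (\<phi> t \<xi> * F \<xi>)))) \<in> borel_measurable lborel"
        using \<phi>_measurable[OF t] by measurable
    qed (use t in \<open>auto simp: convex_real_interval\<close>)
    then have "((\<lambda>\<tau>. \<integral>\<xi>. ?e \<xi> * (\<phi> \<tau> \<xi> * F \<xi>) \<partial>lborel) has_vector_derivative
        (\<integral>\<xi>. ?e \<xi> * (- L t \<xi> * (\<phi> t \<xi> * F \<xi>)) \<partial>lborel)) (at t within {s..})"
      by (simp only: integral_scaleR_right has_vector_derivative_def)
    then have "((\<lambda>\<tau>. inverse_fourier (\<lambda>\<xi>. \<phi> \<tau> \<xi> * F \<xi>) x) has_vector_derivative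
        inverse_fourier (\<lambda>\<xi>. - L t \<xi> * (\<phi> t \<xi> * F \<xi>)) x) (at t within {s..})"
      unfolding inverse_fourier_def by (rule has_vector_derivative_mult_right)
    then have "((\<lambda>\<tau>. u x \<tau>) has_vector_derivative
        inverse_fourier (\<lambda>\<xi>. - L t \<xi> * (\<phi> t \<xi> * F \<xi>)) x) (at t within {s..})"
      by (rule has_vector_derivative_transform[rotated 2]) (use t in \<open>auto simp: u_eq\<close>)
    \<comment> \<open>The product of \<open>\<phi> t\<close> and \<open>F\<close> is itself rapidly
      decaying, so \<open>u (\<cdot>, t)\<close> lies in the domain where the operator is
      specified.\<close>
    moreover have "P_operator \<alpha> \<theta> (b t) (\<lambda>y. u y t) = inverse_fourier (\<lambda>\<xi>. - L t \<xi> * (\<phi> t \<xi> * F \<xi>))"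
      unfolding P_operator_def u_eq[OF t] L_def
      by (rule fourier_multiplier_inverse_fourier[OF \<phi>F[OF t]]) measurable
    ultimately show ?thesis by simp
  qed
  \<comment> \<open>At \<open>t = s\<close> the increment is identically 0 and the expectation is
    that of a constant.\<close>
  moreover have "u x s = f x" for x
    by (simp add: assms(16) transition_def prob_space)
  ultimately show ?thesis by blast
qed

end
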